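(* For a real $C^2$ function $u$ on $\mathscr H$, $\underbrace{\triangle u\wedge\cdots\wedge\triangle u}_{n}=n!\,\det\left(\overline{Q_l}Q_mu+8\delta_{lm}\mathbf i\,\partial_tu\right)_{l,m=0}^{n-1}\,\Omega_{2n}$, where $\det$ is the Moore determinant and $\Omega_{2n}=\omega^0\wedge\omega^n\wedge\omega^1\wedge\omega^{n+1}\wedge\cdots\wedge\omega^{n-1}\wedge\omega^{2n-1}$.
   Context: $\mathscr H=\mathbb R^{4n}\times\mathbb R$ with product $(x,t)\cdot(y,s)=\big(x+y,\,t+s+2\sum_{l=1}^{2n}(x_{2l-1}y_{2l}-x_{2l}y_{2l-1})\big)$ and vector fields $X_{2l-1}=\partial_{x_{2l-1}}-2x_{2l}\partial_t$, $X_{2l}=\partial_{x_{2l}}+2x_{2l-1}\partial_t$ ($l=1,\dots,2n$). With $\mathbf i$ the imaginary unit, for $l=0,\dots,n-1$ define $Z_{l0'}=X_{4l+1}+\mathbf iX_{4l+2}$, $Z_{l1'}=-X_{4l+3}-\mathbf iX_{4l+4}$, $Z_{(n+l)0'}=X_{4l+3}-\mathbf iX_{4l+4}$, $Z_{(n+l)1'}=X_{4l+1}-\mathbf iX_{4l+2}$. Fix a basis $\omega^0,\dots,\omega^{2n-1}$ of $\mathbb C^{2n}$ and define for a function $u$: $\triangle u=\sum_{A,B=0}^{2n-1}\triangle_{AB}u\,\omega^A\wedge\omega^B$ with $\triangle_{AB}u=\frac12(Z_{A0'}Z_{B1'}u-Z_{B0'}Z_{A1'}u)$ (this is $d_0d_1u$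 where $d_\alpha F=\sum_I\sum_AZ_{A\alpha'}f_I\omega^A\wedge\omega^I$). Quaternions $\mathbb H\supset\mathbb C$ have units $1,\mathbf i,\mathbf j,\mathbf k$; $\overline{Q_l}=X_{4l+1}+\mathbf iX_{4l+2}+\mathbf jX_{4l+3}+\mathbf kX_{4l+4}$, $Q_l=X_{4l+1}-\mathbf iX_{4l+2}-\mathbf jX_{4l+3}-\mathbf kX_{4l+4}$. The matrix $(\overline{Q_l}Q_mu+8\delta_{lm}\mathbf i\partial_tu)$ is a hyperhermitian quaternionic $n\times n$ matrix and $\det$ is its Moore determinant. *)

theory Defs
  imports "HOL-Analysis.Analysis" "HOL-Combinatorics.Permutations"
begin

datatype quat = Quat (qre: real) (qi: real) (qj: real) (qk: real)

instantiation quat :: ring_1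
begin
definition "0 = Quat 0 0 0 0"
definition "1 = Quat 1 0 0 0"
definition "a + b = Quat (qre a + qre b) (qi a + qi b) (qj a + qj b) (qk a + qk b)"
definition "a - b = Quat (qre a - qre b) (qi a - qi b) (qj a - qj b) (qk a - qk b)"
definition "- a = Quat (- qre a) (- qi a) (- qj a) (- qk a)"
definition "a * b = Quat
   (qre a * qre b - qi a * qi b - qj a * qj b - qk a * qk b)
   (qre a * qi b + qi a * qre b + qj a * qk b - qk a * qj b)
   (qre a * qj b - qi a * qk b + qj a * qre b + qk a * qi b)
   (qre a * qk b + qi a * qj b - qj a * qi b + qk a * qre b)"
instance
  by standard (simp_all add: zero_quat_def one_quat_def plus_quat_def minus_quat_def
      uminus_quat_def times_quat_def algebra_simps)
end

definition qreal :: "real \<Rightarrow> quat" where "qreal r = Quat r 0 0 0"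
definition quat_of_complex :: "complex \<Rightarrow> quat" where
  "quat_of_complex z = Quat (Re z) (Im z) 0 0"

definition qunit :: "nat \<Rightarrow> quat" where
  "qunit a = (if a = 0 then Quat 1 0 0 0 else if a = 1 then Quat 0 1 0 0
              else if a = 2 then Quat 0 0 1 0 else Quat 0 0 0 1)"
definition qcnj :: "quat \<Rightarrow> quat" where
  "qcnj q = Quat (qre q) (- qi q) (- qj q) (- qk q)"

definition cyc_len :: "(nat \<Rightarrow> nat) \<Rightarrow> nat \<Rightarrow> nat" where
  "cyc_len \<sigma> a = (LEAST k. 0 < k \<and> (\<sigma> ^^ k) a = a)"

definition cyc_prod :: "(nat \<Rightarrow> nat \<Rightarrow> quat) \<Rightarrow> (nat \<Rightarrow> nat) \<Rightarrow> nat \<Rightarrow> quat" where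
  "cyc_prod M \<sigma> a = prod_list (map (\<lambda>k. M ((\<sigma> ^^ k) a) ((\<sigma> ^^ Suc k) a)) [0..<cyc_len \<sigma> a])"

definition cyc_leaders :: "nat \<Rightarrow> (nat \<Rightarrow> nat) \<Rightarrow> nat set" where
  "cyc_leaders n \<sigma> = {a. a < n \<and> (\<forall>k. a \<le> (\<sigma> ^^ k) a)}"

definition moore_det :: "nat \<Rightarrow> (nat \<Rightarrow> nat \<Rightarrow> quat) \<Rightarrow> quat" where
  "moore_det n M = (\<Sum>\<sigma> \<in> {\<sigma>. \<sigma> permutes {..<n}}.
      of_int (sign \<sigma>) *
      prod_list (map (cyc_prod M \<sigma>) (rev (sorted_list_of_set (cyc_leaders n \<sigma>)))))"

text \<open>A form is given by its coefficients w.r.t. the basis omega^I (I increasing).\<close>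
type_synonym form = "nat set \<Rightarrow> complex"

definition shuffle_sign :: "nat set \<Rightarrow> nat set \<Rightarrow> complex" where
  "shuffle_sign I J = (-1) ^ card {(i, j). i \<in> I \<and> j \<in> J \<and> j < i}"

definition wedge :: "form \<Rightarrow> form \<Rightarrow> form" where
  "wedge \<alpha> \<beta> K = (\<Sum>I \<in> Pow K. shuffle_sign I (K - I) * \<alpha> I * \<beta> (K - I))"

definition form_one :: form where "form_one K = (if K = {} then 1 else 0)"

definition omega :: "nat \<Rightarrow> form" where "omega A K = (if K = {A} then 1 else 0)"

fun wedge_pow :: "form \<Rightarrow> nat \<Rightarrow> form" where
  "wedge_pow \<alpha> 0 = form_one"
| "wedge_pow \<alpha> (Suc k) = wedge \<alpha> (wedge_pow \<alpha> k)"

definition Omega :: "nat \<Rightarrow> form" where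
  "Omega n = foldr wedge (map omega (concat (map (\<lambda>l. [l, n + l]) [0..<n]))) form_one"

text \<open>A point of H is represented by p :: nat => real, with p 0 = t and
  p 1, ..., p (4n) = x_1, ..., x_{4n}; other coordinates are irrelevant.\<close>

definition pd :: "nat \<Rightarrow> ((nat \<Rightarrow> real) \<Rightarrow> real) \<Rightarrow> (nat \<Rightarrow> real) \<Rightarrow> real" where
  "pd i f p = deriv (\<lambda>s. f (p(i := s))) (p i)"

definition XX :: "nat \<Rightarrow> ((nat \<Rightarrow> real) \<Rightarrow> real) \<Rightarrow> (nat \<Rightarrow> real) \<Rightarrow> real" where
  "XX j f p = pd j f p + (if odd j then - 2 * p (j + 1) else 2 * p (j - 1)) * pd 0 f p"

definition fun_on_H :: "nat \<Rightarrow> ((nat \<Rightarrow> real) \<Rightarrow> real) \<Rightarrow> bool" where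
  "fun_on_H n u \<longleftrightarrow> (\<forall>p q. (\<forall>i \<le> 4 * n. p i = q i) \<longrightarrow> u p = u q)"

definition C2_on_H :: "nat \<Rightarrow> ((nat \<Rightarrow> real) \<Rightarrow> real) \<Rightarrow> bool" where
  "C2_on_H n u \<longleftrightarrow> fun_on_H n u \<and> continuous_on UNIV u \<and>
     (\<forall>i \<le> 4 * n. \<forall>p. (\<lambda>s. u (p(i := s))) differentiable (at (p i))) \<and>
     (\<forall>i \<le> 4 * n. continuous_on UNIV (pd i u)) \<and>
     (\<forall>i \<le> 4 * n. \<forall>j \<le> 4 * n. \<forall>p. (\<lambda>s. pd i u (p(j := s))) differentiable (at (p j))) \<and>
     (\<forall>i \<le> 4 * n. \<forall>j \<le> 4 * n. continuous_on UNIV (pd j (pd i u)))"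

text \<open>Coefficient of X_j in Z_{A alpha'} (alpha = 0 or 1).\<close>
definition zc :: "nat \<Rightarrow> nat \<Rightarrow> nat \<Rightarrow> nat \<Rightarrow> complex" where
  "zc n A \<alpha> j =
    (if A < n then
       (let l = A in
        if \<alpha> = 0 then (if j = 4*l+1 then 1 else if j = 4*l+2 then \<i> else 0)
        else (if j = 4*l+3 then -1 else if j = 4*l+4 then - \<i> else 0))
     else if A < 2 * n then
       (let l = A - n in
        if \<alpha> = 0 then (if j = 4*l+3 then 1 else if j = 4*l+4 then - \<i> else 0)
        else (if j = 4*l+1 then 1 else if j = 4*l+2 then - \<i> else 0))
     else 0)"

text \<open>Z_{A0'} Z_{B1'} u for real u (the Z's have constant coefficients).\<close>
definition ZZ :: "nat \<Rightarrow> nat \<Rightarrow> nat \<Rightarrow> ((nat \<Rightarrow> real) \<Rightarrow> real) \<Rightarrow> (nat \<Rightarrow> real) \<Rightarrow> complex" where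
  "ZZ n A B u p = (\<Sum>j \<in> {1..4*n}. \<Sum>k \<in> {1..4*n}.
      zc n A 0 j * zc n B 1 k * complex_of_real (XX j (XX k u) p))"

definition DeltaAB :: "nat \<Rightarrow> nat \<Rightarrow> nat \<Rightarrow> ((nat \<Rightarrow> real) \<Rightarrow> real) \<Rightarrow> (nat \<Rightarrow> real) \<Rightarrow> complex" where
  "DeltaAB n A B u p = (ZZ n A B u p - ZZ n B A u p) / 2"

definition Delta :: "nat \<Rightarrow> ((nat \<Rightarrow> real) \<Rightarrow> real) \<Rightarrow> (nat \<Rightarrow> real) \<Rightarrow> form" where
  "Delta n u p K = (\<Sum>A < 2*n. \<Sum>B < 2*n. DeltaAB n A B u p * wedge (omega A) (omega B) K)"

definition QQmat :: "((nat \<Rightarrow> real) \<Rightarrow> real) \<Rightarrow> (nat \<Rightarrow> real) \<Rightarrow> nat \<Rightarrow> nat \<Rightarrow> quat" where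
  "QQmat u p l m = (\<Sum>a < 4. \<Sum>b < 4.
       qunit a * qcnj (qunit b) * qreal (XX (4*l+1+a) (XX (4*m+1+b) u) p))
     + (if l = m then Quat 0 (8 * pd 0 u p) 0 0 else 0)"

end

theory Submission
  imports Defs
begin

text \<open>Left multiplication and contraction by basis covectors generate a Clifford algebra acting on
  forms, so wedging with a 2-form and contracting obey simple commutation rules. Contracting both
  \<open>\<omega>\<^sup>l\<close> and \<open>\<omega>\<^sup>n\<^sup>+\<^sup>l\<close> for all \<open>l\<close> in a vertex set \<open>S\<close> out of the divided power of the 2-form gives
  the Pfaffian of \<open>S\<close>; contracting two further covectors \<open>x\<close>, \<open>y\<close> gives an entry that expands along
  \<open>y\<close> over the vertices of \<open>S\<close>. The Moore determinant of a matrix bordered by row \<open>x\<close> and column \<open>y\<close>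
  expands in the same way, by cutting off the last vertex of the cycle through the border vertex.
  Writing quaternions as pairs of complex numbers, the two recursions coincide, because the entries
  of the quaternionic matrix are the pairs \<open>(2\<triangle>\<^sub>l\<^sub>,\<^sub>n\<^sub>+\<^sub>m u, 2\<triangle>\<^sub>l\<^sub>m u)\<close>; the term \<open>8\<delta>\<^sub>l\<^sub>m \<i>\<partial>\<^sub>t u\<close>
  compensates the commutators \<open>[X\<^sub>2\<^sub>l\<^sub>-\<^sub>1, X\<^sub>2\<^sub>l] = 4\<partial>\<^sub>t\<close>.\<close>

section \<open>Exterior multiplication and contraction\<close>

text \<open>The sign of moving \<open>omega x\<close> to its place in the increasing product over
  \<open>K\<close>. As \<open><\<close> is strict, adding or removing \<open>x\<close> itself does
  not change it.\<close>

definition prefix_sign :: "nat \<Rightarrow> nat set \<Rightarrow> complex" where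
  "prefix_sign x K = (-1) ^ card {j \<in> K. j < x}"

definition omega_mult :: "nat \<Rightarrow> form \<Rightarrow> form" where
  "omega_mult x F K = (if x \<in> K then prefix_sign x K * F (K - {x}) else 0)"

text \<open>Interior product with the vector dual to \<open>omega x\<close>.\<close>

definition contract :: "nat \<Rightarrow> form \<Rightarrow> form" where
  "contract x F K = (if x \<in> K then 0 else prefix_sign x K * F (insert x K))"

lemma prefix_sign_square [simp]: "prefix_sign x K * prefix_sign x K = 1"
  "prefix_sign x K * (prefix_sign x K * z) = z"
proof -
  show *: "prefix_sign x K * prefix_sign x K = 1"
    by (simp add: prefix_sign_def flip: power_add mult_2)
  show "prefix_sign x K * (prefix_sign x K * z) = z"
    by (metis * mult.assoc mult_1)
qed

lemma prefix_sign_insert: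
  assumes "y \<notin> K"
  shows "prefix_sign x (insert y K) = (if y < x then - prefix_sign x K else prefix_sign x K)"
proof (cases "y < x")
  case True
  then have "{j \<in> insert y K. j < x} = insert y {j \<in> K. j < x}" by auto
  with True assms show ?thesis by (simp add: prefix_sign_def)
next
  case False
  then have "{j \<in> insert y K. j < x} = {j \<in> K. j < x}" by auto
  with False show ?thesis by (simp add: prefix_sign_def)
qed

lemma prefix_sign_remove:
  assumes "y \<in> K"
  shows "prefix_sign x (K - {y}) = (if y < x then - prefix_sign x K else prefix_sign x K)"
  using prefix_sign_insert[of y "K - {y}" x] assms by (simp add: insert_absorb split: if_splits)

text \<open>Only the finite set \<open>{j \<in> K. j < x}\<close> enters the sign, so the relations between these operators
  hold at infinite \<open>K\<close> as well and can be stated as equations of functions.\<close>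

lemma contract_omega_mult_same:
  "contract x (omega_mult x F) = (\<lambda>K. F K - omega_mult x (contract x F) K)"
  by (rule HOL.ext)
    (auto simp: contract_def omega_mult_def prefix_sign_insert prefix_sign_remove insert_absorb)

lemma contract_omega_mult_other:
  assumes "x \<noteq> y" shows "contract x (omega_mult y F) = (\<lambda>K. - omega_mult y (contract x F) K)"
proof
  fix K
  show "contract x (omega_mult y F) K = - omega_mult y (contract x F) K"
    using assms
    by (cases "x < y") (auto simp: contract_def omega_mult_def prefix_sign_insert prefix_sign_remove insert_Diff_if)
qed

lemma contract_contract: "contract x (contract y F) = (\<lambda>K. - contract y (contract x F) K)"
proof
  fix K
  show "contract x (contract y F) K = - contract y (contract x F) K"
    by (cases x y rule: linorder_cases) (auto simp: contract_def prefix_sign_insert insert_commute)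
qed

lemma contract_contract_same [simp]: "contract x (contract x F) = (\<lambda>K. 0)"
  by (rule HOL.ext) (auto simp: contract_def)

lemma omega_mult_omega_mult:
  "omega_mult x (omega_mult y F) = (\<lambda>K. - omega_mult y (omega_mult x F) K)"
proof
  fix K
  show "omega_mult x (omega_mult y F) K = - omega_mult y (omega_mult x F) K"
    by (cases x y rule: linorder_cases)
      (auto simp: omega_mult_def prefix_sign_remove Diff_insert2[symmetric] insert_commute)
qed

section \<open>Linear operators on forms and multiplication by a 2-form\<close>

definition form_linear :: "(form \<Rightarrow> form) \<Rightarrow> bool" where
  "form_linear \<Phi> \<longleftrightarrow> (\<forall>F G. \<Phi> (\<lambda>K. F K + G K) = (\<lambda>K. \<Phi> F K + \<Phi> G K)) \<and>
     (\<forall>c F. \<Phi> (\<lambda>K. c * F K) = (\<lambda>K. c * \<Phi> F K))"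

lemma form_linear_add: "form_linear \<Phi> \<Longrightarrow> \<Phi> (\<lambda>K. F K + G K) = (\<lambda>K. \<Phi> F K + \<Phi> G K)"
  and form_linear_scale: "form_linear \<Phi> \<Longrightarrow> \<Phi> (\<lambda>K. c * F K) = (\<lambda>K. c * \<Phi> F K)"
  by (auto simp: form_linear_def)

lemma form_linear_zero: "form_linear \<Phi> \<Longrightarrow> \<Phi> (\<lambda>K. 0) = (\<lambda>K. 0)"
  using form_linear_scale[of \<Phi> 0 "\<lambda>K. 0"] by simp

lemma form_linear_minus: "form_linear \<Phi> \<Longrightarrow> \<Phi> (\<lambda>K. - F K) = (\<lambda>K. - \<Phi> F K)"
  using form_linear_scale[of \<Phi> "-1" F] by simp

lemma form_linear_diff: "form_linear \<Phi> \<Longrightarrow> \<Phi> (\<lambda>K. F K - G K) = (\<lambda>K. \<Phi> F K - \<Phi> G K)"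
  using form_linear_add[of \<Phi> F "\<lambda>K. - G K"] by (simp add: form_linear_minus)

lemma form_linear_sum:
  assumes "form_linear \<Phi>"
  shows "\<Phi> (\<lambda>K. \<Sum>i\<in>I. c i * F i K) = (\<lambda>K. \<Sum>i\<in>I. c i * \<Phi> (F i) K)"
  by (induction I rule: infinite_finite_induct)
    (simp_all add: form_linear_zero[OF assms] form_linear_add[OF assms] form_linear_scale[OF assms])

lemma form_linear_omega_mult: "form_linear (omega_mult x)"
  by (auto simp: form_linear_def omega_mult_def algebra_simps fun_eq_iff)

lemma form_linear_contract: "form_linear (contract x)"
  by (auto simp: form_linear_def contract_def algebra_simps fun_eq_iff)

text \<open>\<open>wedge2 N a\<close> multiplies by the 2-form with coefficients \<open>a\<close>; \<open>row_form N a x\<close> is the commutator of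
  \<open>contract x\<close> with it when \<open>a\<close> is antisymmetric.\<close>

definition wedge2 :: "nat \<Rightarrow> (nat \<Rightarrow> nat \<Rightarrow> complex) \<Rightarrow> form \<Rightarrow> form" where
  "wedge2 N a F K = (\<Sum>A<N. \<Sum>B<N. a A B * omega_mult A (omega_mult B F) K)"

definition row_form :: "nat \<Rightarrow> (nat \<Rightarrow> nat \<Rightarrow> complex) \<Rightarrow> nat \<Rightarrow> form \<Rightarrow> form" where
  "row_form N a x F K = (\<Sum>B<N. 2 * a x B * omega_mult B F K)"

text \<open>Flattening the double sum gives the shape through which \<open>form_linear_sum\<close>
  pushes an operator.\<close>

lemma wedge2_pairs: "wedge2 N a F = (\<lambda>K. \<Sum>q\<in>{..<N} \<times> {..<N}.
    a (fst q) (snd q) * omega_mult (fst q) (omega_mult (snd q) F) K)"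
  by (simp add: wedge2_def fun_eq_iff sum.cartesian_product split_def)

lemma form_linear_wedge2: "form_linear (wedge2 N a)"
  unfolding form_linear_def wedge2_def
  by (simp add: form_linear_add[OF form_linear_omega_mult] form_linear_scale[OF form_linear_omega_mult]
      sum.distrib sum_distrib_left distrib_left mult.left_commute)

text \<open>Passing one covector across two others costs two signs, which cancel.\<close>

lemma omega_mult_wedge2: "omega_mult x (wedge2 N a F) = wedge2 N a (omega_mult x F)"
proof -
  have "omega_mult x (omega_mult A (omega_mult B F)) =
      omega_mult A (omega_mult B (omega_mult x F))" for A B
    by (simp add: omega_mult_omega_mult[of x A] omega_mult_omega_mult[of x B] form_linear_minus[OF form_linear_omega_mult])
  then show ?thesis
    unfolding wedge2_pairs form_linear_sum[OF form_linear_omega_mult] by simp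
qed

lemma row_form_wedge2: "row_form N a x (wedge2 N a F) = wedge2 N a (row_form N a x F)"
  unfolding row_form_def by (simp add: omega_mult_wedge2 form_linear_sum[OF form_linear_wedge2])

lemma contract_row_form:
  assumes "y < N"
  shows "contract y (row_form N a x F) = (\<lambda>K. 2 * a x y * F K - row_form N a x (contract y F) K)"
proof
  fix K
  have *: "2 * a x B * contract y (omega_mult B F) K =
      (if y = B then 2 * a x B * F K else 0) - 2 * a x B * omega_mult B (contract y F) K" for B
    by (cases "y = B") (simp_all add: contract_omega_mult_same contract_omega_mult_other algebra_simps)
  have "contract y (row_form N a x F) K = (\<Sum>B<N. 2 * a x B * contract y (omega_mult B F) K)"
    unfolding row_form_def form_linear_sum[OF form_linear_contract] ..
  also have "\<dots> = (\<Sum>B<N. (if y = B then 2 * a x B * F K else 0)) - row_form N a x (contract y F) K"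
    by (simp add: * row_form_def sum_subtractf)
  finally show "contract y (row_form N a x F) K = 2 * a x y * F K - row_form N a x (contract y F) K"
    using assms by simp
qed

text \<open>The contraction passes two covectors with cancelling signs, leaving one term for
  \<open>x = A\<close> and one for \<open>x = B\<close>. Antisymmetry makes the two sums equal,
  whence the factor 2 in \<open>row_form\<close>.\<close>

lemma contract_wedge2:
  assumes "x < N" and antisym: "\<And>A B. a A B = - a B A"
  shows "contract x (wedge2 N a F) = (\<lambda>K. wedge2 N a (contract x F) K + row_form N a x F K)"
proof
  fix K
  have *: "contract x (omega_mult A (omega_mult B F)) K = omega_mult A (omega_mult B (contract x F)) K
      + (if x = A then omega_mult B F K else 0) - (if x = B then omega_mult A F K else 0)" for A B
  proof -
    have s: "contract x (omega_mult B F) = (\<lambda>K. (if x = B then F K else 0) - omega_mult B (contract x F) K)" for B F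
      by (cases "x = B") (simp_all add: contract_omega_mult_same contract_omega_mult_other)
    have i: "(\<lambda>K. if x = B then F K else 0) = (if x = B then F else (\<lambda>K. 0))" by auto
    show ?thesis
      by (simp add: s form_linear_diff[OF form_linear_omega_mult] i form_linear_zero[OF form_linear_omega_mult])
  qed
  have "contract x (wedge2 N a F) K = (\<Sum>A<N. \<Sum>B<N. a A B * contract x (omega_mult A (omega_mult B F)) K)"
    unfolding wedge2_pairs form_linear_sum[OF form_linear_contract]
    by (simp add: sum.cartesian_product split_def)
  also have "\<dots> = (\<Sum>A<N. \<Sum>B<N. a A B * omega_mult A (omega_mult B (contract x F)) K
      + (if x = A then a A B * omega_mult B F K else 0) - (if x = B then a A B * omega_mult A F K else 0))"
    by (intro sum.cong) (simp_all add: * algebra_simps)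
  also have "\<dots> = wedge2 N a (contract x F) K
      + (\<Sum>A<N. \<Sum>B<N. if x = A then a A B * omega_mult B F K else 0)
      - (\<Sum>A<N. \<Sum>B<N. if x = B then a A B * omega_mult A F K else 0)"
    by (simp add: wedge2_def sum.distrib sum_subtractf)
  also have "(\<Sum>A<N. \<Sum>B<N. if x = A then a A B * omega_mult B F K else 0) = (\<Sum>B<N. a x B * omega_mult B F K)"
    by (subst sum.swap) (use assms(1) in simp)
  also have "(\<Sum>A<N. \<Sum>B<N. if x = B then a A B * omega_mult A F K else 0) = - (\<Sum>B<N. a x B * omega_mult B F K)"
    using assms(1) by (simp add: antisym[of _ x] sum_negf)
  finally show "contract x (wedge2 N a F) K = wedge2 N a (contract x F) K + row_form N a x F K"
    by (simp add: row_form_def sum_distrib_left mult.assoc)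
qed

text \<open>The factorial absorbs the exponent that appears when a power is differentiated.\<close>

definition div_pow :: "nat \<Rightarrow> (nat \<Rightarrow> nat \<Rightarrow> complex) \<Rightarrow> nat \<Rightarrow> form" where
  "div_pow N a k K = 1 / fact k * ((wedge2 N a ^^ k) form_one) K"

lemma form_linear_row_form: "form_linear (row_form N a x)"
  unfolding form_linear_def row_form_def
  by (simp add: form_linear_add[OF form_linear_omega_mult] form_linear_scale[OF form_linear_omega_mult]
      sum.distrib sum_distrib_left distrib_left mult.left_commute)

text \<open>Leibniz rule: the commutator \<open>row_form\<close> itself commutes with
  \<open>wedge2\<close>, so each of the \<open>Suc k\<close> factors contributes the same
  term.\<close>

lemma contract_div_pow:
  assumes "x < N" and antisym: "\<And>A B. a A B = - a B A"
  shows "contract x (div_pow N a (Suc k)) = row_form N a x (div_pow N a k)"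
proof -
  have *: "contract x ((wedge2 N a ^^ Suc k) form_one) =
      (\<lambda>K. of_nat (Suc k) * row_form N a x ((wedge2 N a ^^ k) form_one) K)"
  proof (induction k)
    case 0
    have "contract x form_one = (\<lambda>K. 0)" by (auto simp: contract_def form_one_def)
    then show ?case
      by (simp add: contract_wedge2[OF assms] form_linear_zero[OF form_linear_wedge2])
  next
    case (Suc k)
    have "contract x ((wedge2 N a ^^ Suc (Suc k)) form_one) =
       (\<lambda>K. wedge2 N a (contract x ((wedge2 N a ^^ Suc k) form_one)) K
          + row_form N a x ((wedge2 N a ^^ Suc k) form_one) K)"
      by (simp add: contract_wedge2[OF assms])
    then show ?case
      unfolding Suc form_linear_scale[OF form_linear_wedge2]
      by (simp add: row_form_wedge2[symmetric] algebra_simps)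
  qed
  have "1 / fact (Suc k) * (of_nat (Suc k) * z) = 1 / fact k * z" for z :: complex
    by (simp add: fact_Suc del: of_nat_Suc)
  then show ?thesis
    unfolding div_pow_def form_linear_scale[OF form_linear_contract] *
      form_linear_scale[OF form_linear_row_form] by simp
qed

section \<open>Contraction of pairs of covectors, and Pfaffians\<close>

definition contract_pair :: "nat \<Rightarrow> nat \<Rightarrow> form \<Rightarrow> form" where
  "contract_pair n l F = contract (n + l) (contract l F)"

text \<open>A pair of contractions is an even operator, so different pairs commute and the fold does
  not depend on an order of \<open>S\<close>.\<close>

definition contract_pairs :: "nat \<Rightarrow> nat set \<Rightarrow> form \<Rightarrow> form" where
  "contract_pairs n S F = Finite_Set.fold (contract_pair n) F S"

lemma contract_pair_commute:
  "contract_pair n l (contract_pair n m F) = contract_pair n m (contract_pair n l F)"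
proof -
  have "contract x (contract y (contract z (contract w F))) =
      contract z (contract w (contract x (contract y F)))" for x y z w
    by (simp add: contract_contract[of y z] contract_contract[of y w]
        contract_contract[of x z] contract_contract[of x w]
        form_linear_minus[OF form_linear_contract])
  then show ?thesis by (simp add: contract_pair_def)
qed

interpretation contract_pair: comp_fun_commute "contract_pair n"
  by unfold_locales (simp add: fun_eq_iff contract_pair_commute)

lemma contract_pairs_empty [simp]: "contract_pairs n {} F = F"
  by (simp add: contract_pairs_def)

lemma contract_pairs_insert:
  "finite S \<Longrightarrow> l \<notin> S \<Longrightarrow> contract_pairs n (insert l S) F = contract_pairs n S (contract_pair n l F)"
  by (simp add: contract_pairs_def contract_pair.fold_insert2 del: contract_pair.fold_insert)

lemma form_linear_contract_pair: "form_linear (contract_pair n l)"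
  unfolding form_linear_def contract_pair_def
  by (simp add: form_linear_add[OF form_linear_contract] form_linear_scale[OF form_linear_contract])

lemma form_linear_contract_pairs:
  assumes "finite S" shows "form_linear (contract_pairs n S)"
  using assms
proof (induction S)
  case (insert l S)
  then show ?case
    by (simp add: form_linear_def contract_pairs_insert form_linear_add[OF form_linear_contract_pair]
        form_linear_scale[OF form_linear_contract_pair])
qed (simp add: form_linear_def)

lemma contract_pair_omega_mult:
  assumes "l \<noteq> x" "n + l \<noteq> x"
  shows "contract_pair n l (omega_mult x F) = omega_mult x (contract_pair n l F)"
  using assms by (simp add: contract_pair_def contract_omega_mult_other form_linear_minus[OF form_linear_contract])

text \<open>A covector that meets none of the contractions moves to the front, and a multiple of
  \<open>omega x\<close> has no coefficient at \<open>{}\<close>.\<close>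

lemma contract_pairs_omega_mult_0:
  assumes "finite S" "\<And>l. l \<in> S \<Longrightarrow> l \<noteq> x \<and> n + l \<noteq> x"
  shows "contract_pairs n S (omega_mult x F) {} = 0"
proof -
  have "contract_pairs n S (omega_mult x F) = omega_mult x (contract_pairs n S F)"
    using assms by (induction S arbitrary: F) (simp_all add: contract_pairs_insert contract_pair_omega_mult)
  then show ?thesis by (simp add: omega_mult_def)
qed

text \<open>Only the contraction by \<open>c\<close> can remove the covector \<open>c\<close>; its
  partner \<open>n + c\<close> is left over as a single contraction. The term in which the covector
  survives vanishes at \<open>{}\<close>.\<close>

lemma contract_pairs_omega_mult_low:
  assumes S: "finite S" "S \<subseteq> {..<n}" "c \<in> S"
  shows "contract_pairs n S (omega_mult c F) {} = contract_pairs n (S - {c}) (contract (n + c) F) {}"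
proof -
  have n: "n + c \<noteq> c" "c < n" using S by auto
  have "contract_pair n c (omega_mult c F) = (\<lambda>K. contract (n + c) F K + omega_mult c (contract_pair n c F) K)"
    using n by (simp add: contract_pair_def contract_omega_mult_same contract_omega_mult_other
        form_linear_diff[OF form_linear_contract])
  moreover have "contract_pairs n S (omega_mult c F) =
      contract_pairs n (S - {c}) (contract_pair n c (omega_mult c F))"
    using contract_pairs_insert[of "S - {c}" c n] S by (simp add: insert_absorb)
  moreover have "contract_pairs n (S - {c}) (omega_mult c (contract_pair n c F)) {} = 0"
    using S n by (intro contract_pairs_omega_mult_0) auto
  ultimately show ?thesis
    using S by (simp add: form_linear_add[OF form_linear_contract_pairs])
qed

text \<open>The mirror case. The sign comes from moving the covector \<open>n + c\<close> past the
  contraction by \<open>c\<close>, which acts first.\<close>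

lemma contract_pairs_omega_mult_high:
  assumes S: "finite S" "S \<subseteq> {..<n}" "c \<in> S"
  shows "contract_pairs n S (omega_mult (n + c) F) {} = - contract_pairs n (S - {c}) (contract c F) {}"
proof -
  have n: "c \<noteq> n + c" "c < n" using S by auto
  have "contract_pair n c (omega_mult (n + c) F) = (\<lambda>K. - contract c F K + omega_mult (n + c) (contract_pair n c F) K)"
    using n by (simp add: contract_pair_def contract_omega_mult_same contract_omega_mult_other
        form_linear_minus[OF form_linear_contract])
  moreover have "contract_pairs n S (omega_mult (n + c) F) =
      contract_pairs n (S - {c}) (contract_pair n c (omega_mult (n + c) F))"
    using contract_pairs_insert[of "S - {c}" c n] S by (simp add: insert_absorb)
  moreover have "contract_pairs n (S - {c}) (omega_mult (n + c) (contract_pair n c F)) {} = 0"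
    using S n by (intro contract_pairs_omega_mult_0) auto
  moreover have "form_linear (contract_pairs n (S - {c}))"
    using S by (simp add: form_linear_contract_pairs)
  ultimately show ?thesis
    using form_linear_diff[of "contract_pairs n (S - {c})" "omega_mult (n + c) (contract_pair n c F)" "contract c F"]
    by simp
qed

text \<open>For antisymmetric \<open>a\<close> this is the Pfaffian of the matrix with entries
  \<open>2 * a A B\<close> on the indices \<open>l\<close>, \<open>n + l\<close> for
  \<open>l\<close> in \<open>S\<close>, each pair adjacent. The exponent \<open>card S\<close> gives
  degree \<open>2 * card S\<close>, so the contractions leave a number, read off at
  \<open>{}\<close>.\<close>

definition pf :: "nat \<Rightarrow> (nat \<Rightarrow> nat \<Rightarrow> complex) \<Rightarrow> nat set \<Rightarrow> complex" where
  "pf n a S = contract_pairs n S (div_pow (2 * n) a (card S)) {}"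

text \<open>The same Pfaffian with \<open>x\<close>, \<open>y\<close> placed before the pairs; the
  exponent is one higher to make room for them.\<close>

definition pf2 :: "nat \<Rightarrow> (nat \<Rightarrow> nat \<Rightarrow> complex) \<Rightarrow> nat set \<Rightarrow> nat \<Rightarrow> nat \<Rightarrow> complex" where
  "pf2 n a S x y = contract_pairs n S (contract y (contract x (div_pow (2 * n) a (Suc (card S))))) {}"

lemma pf2_swap: "finite S \<Longrightarrow> pf2 n a S x y = - pf2 n a S y x"
  by (simp add: pf2_def contract_contract[of y x] form_linear_minus[OF form_linear_contract_pairs])

lemma pf2_same: "finite S \<Longrightarrow> pf2 n a S x x = 0"
  by (simp add: pf2_def form_linear_zero[OF form_linear_contract_pairs])

lemma pf_insert: "finite S \<Longrightarrow> l \<notin> S \<Longrightarrow> pf n a (insert l S) = pf2 n a S l (n + l)"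
  by (simp add: pf_def pf2_def contract_pairs_insert contract_pair_def)

lemma pf_empty: "pf n a {} = 1"
  by (simp add: pf_def div_pow_def form_one_def)

text \<open>Pfaffian expansion along row \<open>x\<close>. Contracting \<open>x\<close> turns one
  factor of the divided power into its row; the covector of that row is then removed either by
  \<open>y\<close> or by a member of some pair \<open>c\<close>, and in the latter case the other
  member joins \<open>y\<close>.\<close>

lemma pf2_rec:
  assumes S: "finite S" "S \<subseteq> {..<n}" and xy: "x < 2 * n" "y < 2 * n"
    and antisym: "\<And>A B. a A B = - a B A"
  shows "pf2 n a S x y = 2 * a x y * pf n a S
    - (\<Sum>c\<in>S. 2 * a x c * pf2 n a (S - {c}) y (n + c) - 2 * a x (n + c) * pf2 n a (S - {c}) y c)"
proof -
  let ?k = "card S" and ?T = "div_pow (2 * n) a" and ?C = "contract_pairs n S"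
  have "pf2 n a S x y = ?C (\<lambda>K. 2 * a x y * ?T ?k K - row_form (2 * n) a x (contract y (?T ?k)) K) {}"
    by (simp add: pf2_def contract_div_pow[OF xy(1) antisym] contract_row_form[OF xy(2)])
  also have "\<dots> = 2 * a x y * pf n a S
      - (\<Sum>B<2*n. 2 * a x B * ?C (omega_mult B (contract y (?T ?k))) {})"
    using S by (simp add: form_linear_diff[OF form_linear_contract_pairs] form_linear_scale[OF form_linear_contract_pairs]
        row_form_def form_linear_sum[OF form_linear_contract_pairs] pf_def)
  \<comment> \<open>The indices below \<open>2 * n\<close> are grouped into pairs \<open>c\<close>,
    \<open>n + c\<close>, so that each pair can be compared with \<open>S\<close>.\<close>
  also have "(\<Sum>B<2*n. 2 * a x B * ?C (omega_mult B (contract y (?T ?k))) {}) =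
      (\<Sum>c<n. 2 * a x c * ?C (omega_mult c (contract y (?T ?k))) {}
         + 2 * a x (n + c) * ?C (omega_mult (n + c) (contract y (?T ?k))) {})"
  proof -
    have "(\<Sum>B<2*n. f B) = (\<Sum>c<n. f c + f (n + c))" for f :: "nat \<Rightarrow> complex"
    proof -
      have "{..<2*n} = {..<n} \<union> (+) n ` {..<n}"
      proof (intro set_eqI iffI)
        fix b assume "b \<in> {..<2*n}"
        then show "b \<in> {..<n} \<union> (+) n ` {..<n}"
          by (cases "b < n") (auto intro!: image_eqI[of b _ "b - n"])
      qed auto
      then have "(\<Sum>B<2*n. f B) = (\<Sum>c<n. f c) + sum f ((+) n ` {..<n})"
        by (simp only:) (rule sum.union_disjoint; auto)
      then show ?thesis by (simp add: sum.reindex sum.distrib)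
    qed
    then show ?thesis .
  qed
  also have "\<dots> = (\<Sum>c\<in>S. 2 * a x c * ?C (omega_mult c (contract y (?T ?k))) {}
         + 2 * a x (n + c) * ?C (omega_mult (n + c) (contract y (?T ?k))) {})"
  proof (rule sum.mono_neutral_right)
    show "\<forall>i\<in>{..<n} - S. 2 * a x i * ?C (omega_mult i (contract y (?T ?k))) {}
         + 2 * a x (n + i) * ?C (omega_mult (n + i) (contract y (?T ?k))) {} = 0"
    proof
      fix i assume i: "i \<in> {..<n} - S"
      have "?C (omega_mult i F) {} = 0" "?C (omega_mult (n + i) F) {} = 0" for F
        using i S by (auto intro!: contract_pairs_omega_mult_0)
      then show "2 * a x i * ?C (omega_mult i (contract y (?T ?k))) {}
         + 2 * a x (n + i) * ?C (omega_mult (n + i) (contract y (?T ?k))) {} = 0" by simp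
    qed
  qed (use S in auto)
  also have "\<dots> = (\<Sum>c\<in>S. 2 * a x c * pf2 n a (S - {c}) y (n + c)
      - 2 * a x (n + c) * pf2 n a (S - {c}) y c)"
  proof (rule sum.cong)
    fix c assume c: "c \<in> S"
    \<comment> \<open>The exponent in \<open>pf2\<close> for \<open>S - {c}\<close> is exactly the
      one left after the contraction by \<open>x\<close>.\<close>
    have "Suc (card (S - {c})) = ?k" using S c by (metis card.remove)
    then show "2 * a x c * ?C (omega_mult c (contract y (?T ?k))) {}
         + 2 * a x (n + c) * ?C (omega_mult (n + c) (contract y (?T ?k))) {} =
         2 * a x c * pf2 n a (S - {c}) y (n + c) - 2 * a x (n + c) * pf2 n a (S - {c}) y c"
      using S c by (simp add: contract_pairs_omega_mult_low contract_pairs_omega_mult_high pf2_def)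
  qed simp
  finally show ?thesis .
qed

section \<open>The Moore determinant\<close>

definition leaders :: "nat set \<Rightarrow> (nat \<Rightarrow> nat) \<Rightarrow> nat set" where
  "leaders S \<sigma> = {a \<in> S. \<forall>k. a \<le> (\<sigma> ^^ k) a}"

definition moore_term :: "(nat \<Rightarrow> nat \<Rightarrow> quat) \<Rightarrow> nat set \<Rightarrow> (nat \<Rightarrow> nat) \<Rightarrow> quat" where
  "moore_term M S \<sigma> = of_int (sign \<sigma>) *
      prod_list (map (cyc_prod M \<sigma>) (rev (sorted_list_of_set (leaders S \<sigma>))))"

text \<open>The Moore determinant over an arbitrary finite index set, so that the recursion can
  delete vertices without renumbering.\<close>

definition set_det :: "(nat \<Rightarrow> nat \<Rightarrow> quat) \<Rightarrow> nat set \<Rightarrow> quat" where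
  "set_det M S = (\<Sum>\<sigma> | \<sigma> permutes S. moore_term M S \<sigma>)"

lemma moore_det_eq: "moore_det n M = set_det M {..<n}"
  by (simp add: moore_det_def set_det_def moore_term_def cyc_leaders_def leaders_def)

lemma set_det_empty: "set_det M {} = 1"
  by (simp add: set_det_def moore_term_def leaders_def)

lemma funpow_permutes: "\<sigma> permutes S \<Longrightarrow> a \<in> S \<Longrightarrow> (\<sigma> ^^ k) a \<in> S"
  by (induction k) (auto simp: permutes_in_image)

lemma cyc_len:
  assumes "finite S" "\<sigma> permutes S"
  shows "0 < cyc_len \<sigma> a" and "(\<sigma> ^^ cyc_len \<sigma> a) a = a"
    and "0 < k \<Longrightarrow> k < cyc_len \<sigma> a \<Longrightarrow> (\<sigma> ^^ k) a \<noteq> a"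
proof -
  have "permutation \<sigma>" using assms permutation_permutes by blast
  then obtain m where "(\<sigma> ^^ m) a = a" "m > 0"
    by (metis permutation_self)
  then have "\<exists>k. 0 < k \<and> (\<sigma> ^^ k) a = a" by blast
  from LeastI_ex[OF this] show "0 < cyc_len \<sigma> a" "(\<sigma> ^^ cyc_len \<sigma> a) a = a"
    unfolding cyc_len_def by auto
  show "0 < k \<Longrightarrow> k < cyc_len \<sigma> a \<Longrightarrow> (\<sigma> ^^ k) a \<noteq> a"
    unfolding cyc_len_def by (auto dest: not_less_Least)
qed

lemma cyc_len_eqI:
  assumes "0 < m" "(\<sigma> ^^ m) a = a" "\<And>k. 0 < k \<Longrightarrow> k < m \<Longrightarrow> (\<sigma> ^^ k) a \<noteq> a"
  shows "cyc_len \<sigma> a = m"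
  unfolding cyc_len_def by (rule Least_equality) (use assms not_less in auto)

lemma moore_term_cong:
  assumes "\<sigma> permutes S" "finite S" "\<And>i j. i \<in> S \<Longrightarrow> j \<in> S \<Longrightarrow> M i j = N i j"
  shows "moore_term M S \<sigma> = moore_term N S \<sigma>"
proof -
  have "finite (leaders S \<sigma>)" using assms by (simp add: leaders_def)
  moreover have "cyc_prod M \<sigma> a = cyc_prod N \<sigma> a" if "a \<in> leaders S \<sigma>" for a
  proof -
    have "(\<sigma> ^^ k) a \<in> S" for k using that assms by (simp add: leaders_def funpow_permutes)
    from this this[of "Suc _"] show ?thesis by (simp add: cyc_prod_def assms(3))
  qed
  ultimately have "map (cyc_prod M \<sigma>) (rev (sorted_list_of_set (leaders S \<sigma>))) =
      map (cyc_prod N \<sigma>) (rev (sorted_list_of_set (leaders S \<sigma>)))"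
    by simp
  then show ?thesis unfolding moore_term_def by metis
qed

lemma set_det_cong:
  assumes "finite S" "\<And>i j. i \<in> S \<Longrightarrow> j \<in> S \<Longrightarrow> M i j = N i j"
  shows "set_det M S = set_det N S"
  unfolding set_det_def by (rule sum.cong) (auto intro: moore_term_cong assms)

lemma sorted_list_of_set_insert_min:
  assumes "finite L" "\<And>x. x \<in> L \<Longrightarrow> (z :: nat) < x"
  shows "sorted_list_of_set (insert z L) = z # sorted_list_of_set L"
proof -
  have "z \<notin> L" using assms by auto
  moreover have "insort z (sorted_list_of_set L) = z # sorted_list_of_set L"
    by (rule insort_is_Cons) (use assms in \<open>auto intro: less_imp_le\<close>)
  ultimately show ?thesis using assms by simp
qed

text \<open>Cycles are multiplied by decreasing leader, so the cycle of the overall minimum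
  \<open>z\<close> stands at the right end.\<close>

lemma moore_term_insert_min:
  assumes S: "finite S" "\<And>s. s \<in> S \<Longrightarrow> z < s" and L: "L \<subseteq> S" and ld: "leaders T \<sigma> = insert z L"
  shows "moore_term M T \<sigma> = of_int (sign \<sigma>) *
    (prod_list (map (cyc_prod M \<sigma>) (rev (sorted_list_of_set L))) * cyc_prod M \<sigma> z)"
proof -
  have "finite L" "\<And>x. x \<in> L \<Longrightarrow> z < x" using S L finite_subset by auto
  then show ?thesis by (simp add: moore_term_def ld sorted_list_of_set_insert_min
      del: sorted_list_of_set.sorted_key_list_of_set_insert_remove)
qed

lemma moore_term_fixed:
  assumes S: "finite S" "\<And>s. s \<in> S \<Longrightarrow> z < s" and \<sigma>: "\<sigma> permutes S"
  shows "moore_term M (insert z S) \<sigma> = moore_term M S \<sigma> * M z z"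
proof -
  have z: "\<sigma> z = z" using S \<sigma> by (meson less_irrefl permutes_not_in)
  then have zk: "(\<sigma> ^^ k) z = z" for k by (induction k) auto
  have "leaders (insert z S) \<sigma> = insert z (leaders S \<sigma>)"
    by (auto simp: leaders_def zk)
  then have "moore_term M (insert z S) \<sigma> = of_int (sign \<sigma>) *
     (prod_list (map (cyc_prod M \<sigma>) (rev (sorted_list_of_set (leaders S \<sigma>)))) * cyc_prod M \<sigma> z)"
    by (intro moore_term_insert_min[OF S]) (auto simp: leaders_def)
  moreover have "cyc_len \<sigma> z = 1"
    by (rule cyc_len_eqI) (auto simp: z)
  then have "cyc_prod M \<sigma> z = M z z"
    by (simp add: cyc_prod_def z)
  ultimately show ?thesis by (simp add: moore_term_def mult.assoc)
qed

text \<open>The last vertex of the cycle through the minimum is cut off; the last factor stands at the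
  right end of the Moore product, so no commutation of quaternions is involved.\<close>

lemma moore_term_moved:
  assumes S: "finite S" "\<And>s. s \<in> S \<Longrightarrow> z < s" and c: "c \<in> S"
    and \<tau>: "\<tau> permutes insert z (S - {c})"
  defines "\<sigma> \<equiv> Transposition.transpose z c \<circ> \<tau>"
  shows "moore_term M (insert z S) \<sigma> =
    - (moore_term (\<lambda>i j. if j = z then M i c else M i j) (insert z (S - {c})) \<tau> * M c z)"
proof -
  let ?T = "insert z (S - {c})" and ?N = "\<lambda>i j. if j = z then M i c else M i j"
  have zc: "z \<noteq> c" "z \<notin> S" using S c by auto
  have fT: "finite ?T" using S by simp
  have \<tau>c: "\<tau> c = c" using \<tau> zc by (simp add: permutes_not_in)
  have \<sigma>: "\<sigma> permutes insert z S"
    unfolding \<sigma>_def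
    by (rule permutes_compose) (use \<tau> c in \<open>auto intro: permutes_subset permutes_swap_id\<close>)
  have sgn: "sign \<sigma> = - sign \<tau>"
    using zc permutes_imp_permutation[OF fT \<tau>]
    by (simp add: \<sigma>_def sign_compose permutation_swap_id sign_swap_id)
  \<comment> \<open>The two permutations differ only at \<open>c\<close> and at the
    \<open>\<tau>\<close>-predecessor of \<open>z\<close>: \<open>c\<close> is spliced in between
    that predecessor and \<open>z\<close>.\<close>
  have \<sigma>z: "\<sigma> i = \<tau> i" if "i \<noteq> c" "\<tau> i \<noteq> z" for i
  proof -
    have "\<tau> i \<noteq> c" using that \<tau>c permutes_inj[OF \<tau>] by (metis injD)
    then show ?thesis using that by (simp add: \<sigma>_def transpose_def)
  qed
  have \<sigma>c: "\<sigma> c = z" by (simp add: \<sigma>_def \<tau>c)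
  have notc: "(\<tau> ^^ k) i \<noteq> c" if "i \<in> ?T" for i k
    using funpow_permutes[OF \<tau> that, of k] zc by auto
  define l where "l = cyc_len \<tau> z"
  note l = cyc_len[OF fT \<tau>, where a = z, folded l_def]
  have pow_lt: "(\<sigma> ^^ k) z = (\<tau> ^^ k) z" if "k < l" for k
    using that
  proof (induction k)
    case (Suc k)
    then have "(\<tau> ^^ Suc k) z \<noteq> z" using l(3)[of "Suc k"] by simp
    then show ?case using Suc notc[of z k] by (simp add: \<sigma>z)
  qed simp
  have pow_l: "(\<sigma> ^^ l) z = c"
  proof -
    obtain m where m: "l = Suc m" using l(1) by (cases l) auto
    then have "\<tau> ((\<tau> ^^ m) z) = z" using l(2) by simp
    then show ?thesis using pow_lt[of m] m by (simp add: \<sigma>_def)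
  qed
  have pow_Suc: "(\<sigma> ^^ Suc l) z = z" by (simp add: pow_l \<sigma>c)
  have len: "cyc_len \<sigma> z = Suc l"
  proof (rule cyc_len_eqI)
    fix k assume k: "0 < k" "k < Suc l"
    then show "(\<sigma> ^^ k) z \<noteq> z"
      using l(3)[of k] pow_lt[of k] pow_l zc by (cases "k = l") auto
  qed (use pow_Suc in auto)
  have prod_z: "cyc_prod M \<sigma> z = cyc_prod ?N \<tau> z * M c z"
  proof -
    \<comment> \<open>The step closing the \<open>\<tau>\<close>-cycle at \<open>z\<close> is the
      step of \<open>\<sigma>\<close> into \<open>c\<close>; this is why column \<open>z\<close> of
      \<open>?N\<close> holds column \<open>c\<close> of \<open>M\<close>. Earlier steps do not end
      in \<open>z\<close>.\<close>
    have "M ((\<sigma> ^^ k) z) ((\<sigma> ^^ Suc k) z) = ?N ((\<tau> ^^ k) z) ((\<tau> ^^ Suc k) z)" if "k < l" for k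
    proof (cases "Suc k = l")
      case True
      then show ?thesis using pow_l pow_lt[of k] l(2) that by (simp del: funpow.simps)
    next
      case False
      then have "Suc k < l" using that by simp
      then show ?thesis using pow_lt[of k] pow_lt[of "Suc k"] l(3)[of "Suc k"] that
        by (simp del: funpow.simps)
    qed
    then have "map (\<lambda>k. M ((\<sigma> ^^ k) z) ((\<sigma> ^^ Suc k) z)) [0..<l]
        = map (\<lambda>k. ?N ((\<tau> ^^ k) z) ((\<tau> ^^ Suc k) z)) [0..<l]"
      by (simp del: funpow.simps)
    moreover have "map (\<lambda>k. M ((\<sigma> ^^ k) z) ((\<sigma> ^^ Suc k) z)) [0..<Suc l] =
        map (\<lambda>k. M ((\<sigma> ^^ k) z) ((\<sigma> ^^ Suc k) z)) [0..<l] @ [M c z]"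
      using pow_l pow_Suc by (simp del: funpow.simps)
    ultimately show ?thesis
      unfolding cyc_prod_def len l_def[symmetric] by (simp only: prod_list.append) simp
  qed
  have off: "(\<sigma> ^^ k) a = (\<tau> ^^ k) a" if "a \<in> ?T" "\<And>k. (\<tau> ^^ k) a \<noteq> z" for a k
  proof (induction k)
    case (Suc k)
    show ?case using Suc notc[OF that(1), of k] that(2)[of "Suc k"] by (simp add: \<sigma>z)
  qed simp
  define L where "L = leaders ?T \<tau> - {z}"
  \<comment> \<open>Because \<open>z\<close> lies below all other vertices, a leader different from
    \<open>z\<close> has an orbit avoiding \<open>z\<close>.\<close>
  have L: "a \<in> ?T \<and> (\<forall>k. (\<tau> ^^ k) a \<noteq> z)" if "a \<in> L" for a
  proof -
    have a: "a \<in> S" "a \<in> ?T" "\<And>k. a \<le> (\<tau> ^^ k) a" using that by (auto simp: L_def leaders_def)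
    then show ?thesis using S(2)[of a] by (metis leD)
  qed
  have z_le: "z \<le> (\<tau> ^^ k) z" for k
    using funpow_permutes[OF \<tau>, of z k] S(2) by (auto intro: less_imp_le)
  have z_le': "z \<le> (\<sigma> ^^ k) z" for k
    using funpow_permutes[OF \<sigma>, of z k] S(2) by (auto intro: less_imp_le)
  have ld\<tau>: "leaders ?T \<tau> = insert z L"
    using z_le by (auto simp: L_def leaders_def)
  have ld\<sigma>: "leaders (insert z S) \<sigma> = insert z L"
  proof (intro equalityI subsetI)
    fix a assume a: "a \<in> insert z L"
    show "a \<in> leaders (insert z S) \<sigma>"
    proof (cases "a = z")
      case False
      then have "a \<in> ?T" "\<And>k. (\<tau> ^^ k) a \<noteq> z" using a L[of a] by auto
      from off[OF this] show ?thesis using a False by (auto simp: leaders_def L_def)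
    qed (use z_le' in \<open>simp add: leaders_def\<close>)
  next
    fix a assume a: "a \<in> leaders (insert z S) \<sigma>"
    show "a \<in> insert z L"
    proof (cases "a = z")
      case False
      then have aS: "a \<in> S" "z < a" using a S by (auto simp: leaders_def)
      have le: "a \<le> (\<sigma> ^^ k) a" for k using a by (auto simp: leaders_def)
      \<comment> \<open>The orbit stays at or above \<open>a > z\<close>, so it avoids
        \<open>z\<close>, and therefore also \<open>c\<close>, which \<open>\<sigma>\<close> sends
        to \<open>z\<close>. On such an orbit \<open>\<sigma>\<close> and \<open>\<tau>\<close>
        agree.\<close>
      have nz: "(\<sigma> ^^ k) a \<noteq> z" for k using le[of k] aS by auto
      have "a \<noteq> c" using nz[of 1] \<sigma>c by auto
      have eq: "(\<sigma> ^^ k) a = (\<tau> ^^ k) a \<and> (\<tau> ^^ k) a \<noteq> z" for k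
      proof (induction k)
        case (Suc k)
        have nc: "(\<tau> ^^ k) a \<noteq> c" using notc aS \<open>a \<noteq> c\<close> by auto
        have "\<tau> ((\<tau> ^^ k) a) \<noteq> z"
        proof
          assume "\<tau> ((\<tau> ^^ k) a) = z"
          moreover have "(\<sigma> ^^ Suc k) a = Transposition.transpose z c (\<tau> ((\<sigma> ^^ k) a))"
            by (simp add: \<sigma>_def)
          ultimately have "(\<sigma> ^^ Suc k) a = c" using Suc by simp
          then have "(\<sigma> ^^ Suc (Suc k)) a = z" using \<sigma>c by simp
          then show False using nz by blast
        qed
        then show ?case using Suc nc by (simp add: \<sigma>z)
      qed (use False in auto)
      then show ?thesis using aS \<open>a \<noteq> c\<close> le False by (auto simp: L_def leaders_def)
    qed simp
  qed
  \<comment> \<open>These cycles never enter \<open>z\<close>, so the altered column does not occur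
    in them.\<close>
  have prod_a: "cyc_prod M \<sigma> a = cyc_prod ?N \<tau> a" if "a \<in> L" for a
  proof -
    have eq: "(\<sigma> ^^ k) a = (\<tau> ^^ k) a" "(\<tau> ^^ k) a \<noteq> z" for k
      using L[OF that] off[of a k] by auto
    then show ?thesis
      unfolding cyc_prod_def cyc_len_def by (simp only: eq if_False)
  qed
  have LS: "L \<subseteq> S" "L \<subseteq> S - {c}" "finite L"
    using S by (auto simp: L_def leaders_def)
  have "map (cyc_prod M \<sigma>) (rev (sorted_list_of_set L)) =
      map (cyc_prod ?N \<tau>) (rev (sorted_list_of_set L))"
    using LS prod_a by auto
  moreover have "moore_term M (insert z S) \<sigma> = of_int (sign \<sigma>) *
    (prod_list (map (cyc_prod M \<sigma>) (rev (sorted_list_of_set L))) * cyc_prod M \<sigma> z)"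
    by (rule moore_term_insert_min[OF S LS(1) ld\<sigma>])
  moreover have "moore_term ?N ?T \<tau> = of_int (sign \<tau>) *
    (prod_list (map (cyc_prod ?N \<tau>) (rev (sorted_list_of_set L))) * cyc_prod ?N \<tau> z)"
    by (rule moore_term_insert_min[OF _ _ LS(2) ld\<tau>]) (use S in auto)
  ultimately show ?thesis by (simp add: sgn prod_z mult.assoc del: map_eq_conv)
qed

text \<open>Permutations are sorted by the predecessor \<open>c\<close> of \<open>z\<close>. For
  \<open>c = z\<close> the vertex is a fixed point; otherwise \<open>c\<close> is cut out of the
  cycle by \<open>moore_term_moved\<close>.\<close>

lemma set_det_insert_min:
  assumes S: "finite S" "\<And>s. s \<in> S \<Longrightarrow> z < s"
  shows "set_det M (insert z S) = set_det M S * M z z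
    - (\<Sum>c\<in>S. set_det (\<lambda>i j. if j = z then M i c else M i j) (insert z (S - {c})) * M c z)"
proof -
  have zS: "z \<notin> S" using S by auto
  let ?P = "\<lambda>c. {\<sigma>. \<sigma> permutes insert z S \<and> \<sigma> c = z}"
  have fin: "finite {\<sigma>. \<sigma> permutes insert z S}" using S by (simp add: finite_permutations)
  have "\<sigma> permutes insert z S \<and> \<sigma> z = z \<longleftrightarrow> \<sigma> permutes S" for \<sigma>
  proof
    assume "\<sigma> permutes insert z S \<and> \<sigma> z = z"
    then show "\<sigma> permutes S" by (auto elim: permutes_superset)
  next
    assume \<sigma>: "\<sigma> permutes S"
    then have "\<sigma> permutes insert z S" by (rule permutes_subset) auto
    with \<sigma> zS show "\<sigma> permutes insert z S \<and> \<sigma> z = z"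
      by (simp add: permutes_not_in)
  qed
  then have fixing: "?P z = {\<sigma>. \<sigma> permutes S}" by simp
  have "{\<sigma>. \<sigma> permutes insert z S} = (\<Union>c\<in>insert z S. ?P c)"
  proof (intro equalityI subsetI)
    fix \<sigma> assume "\<sigma> \<in> {\<sigma>. \<sigma> permutes insert z S}"
    then have \<sigma>: "\<sigma> permutes insert z S" by simp
    have "z \<in> \<sigma> ` insert z S" unfolding permutes_image[OF \<sigma>] by simp
    then obtain c where "c \<in> insert z S" "\<sigma> c = z" by (metis imageE)
    with \<sigma> show "\<sigma> \<in> (\<Union>c\<in>insert z S. ?P c)" by blast
  qed auto
  then have "set_det M (insert z S) = (\<Sum>\<sigma>\<in>(\<Union>c\<in>insert z S. ?P c). moore_term M (insert z S) \<sigma>)"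
    by (simp add: set_det_def)
  also have "\<dots> = (\<Sum>c\<in>insert z S. \<Sum>\<sigma>\<in>?P c. moore_term M (insert z S) \<sigma>)"
  proof (rule sum.UNION_disjoint)
    show "\<forall>i\<in>insert z S. \<forall>j\<in>insert z S. i \<noteq> j \<longrightarrow> ?P i \<inter> ?P j = {}"
    proof (intro ballI impI)
      fix i j :: nat assume "i \<noteq> j"
      then have False if "\<sigma> permutes insert z S" "\<sigma> i = z" "\<sigma> j = z" for \<sigma>
        using permutes_inj[OF that(1)] that(2,3) by (metis injD)
      then show "?P i \<inter> ?P j = {}" by blast
    qed
  qed (use S fin in auto)
  also have "\<dots> = (\<Sum>\<sigma>\<in>?P z. moore_term M (insert z S) \<sigma>)
      + (\<Sum>c\<in>S. \<Sum>\<sigma>\<in>?P c. moore_term M (insert z S) \<sigma>)"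
    using S zS by simp
  also have "(\<Sum>\<sigma>\<in>?P z. moore_term M (insert z S) \<sigma>) = set_det M S * M z z"
    by (simp only: fixing) (simp add: set_det_def sum_distrib_right moore_term_fixed[OF S])
  also have "(\<Sum>c\<in>S. \<Sum>\<sigma>\<in>?P c. moore_term M (insert z S) \<sigma>) =
     (\<Sum>c\<in>S. - (set_det (\<lambda>i j. if j = z then M i c else M i j) (insert z (S - {c})) * M c z))"
  proof (rule sum.cong)
    fix c assume c: "c \<in> S"
    let ?N = "\<lambda>i j. if j = z then M i c else M i j"
    have "(\<Sum>\<sigma>\<in>?P c. moore_term M (insert z S) \<sigma>) =
       (\<Sum>\<tau> | \<tau> permutes insert z (S - {c}).
         moore_term M (insert z S) (Transposition.transpose z c \<circ> \<tau>))"
    \<comment> \<open>Composition with the transposition is its own inverse, so it serves as witness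
      in both directions.\<close>
    proof (rule sum.reindex_bij_witness[of _ "\<lambda>\<tau>. Transposition.transpose z c \<circ> \<tau>"
          "\<lambda>\<sigma>. Transposition.transpose z c \<circ> \<sigma>"])
      fix \<sigma> assume \<sigma>: "\<sigma> \<in> ?P c"
      show "Transposition.transpose z c \<circ> \<sigma> \<in> {\<tau>. \<tau> permutes insert z (S - {c})}"
      proof (rule CollectI, rule permutes_superset)
        show "Transposition.transpose z c \<circ> \<sigma> permutes insert z S"
          using \<sigma> c by (auto intro!: permutes_compose permutes_swap_id)
      qed (use \<sigma> in auto)
    next
      fix \<tau> assume "\<tau> \<in> {\<tau>. \<tau> permutes insert z (S - {c})}"
      then have \<tau>: "\<tau> permutes insert z (S - {c})" by simp
      have "\<tau> c = c" using c zS by (intro permutes_not_in[OF \<tau>]) auto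
      moreover have "\<tau> permutes insert z S" using \<tau> by (rule permutes_subset) auto
      then have "Transposition.transpose z c \<circ> \<tau> permutes insert z S"
        using c by (auto intro!: permutes_compose permutes_swap_id)
      ultimately show "Transposition.transpose z c \<circ> \<tau> \<in> ?P c" by simp
    qed (auto simp: comp_assoc[symmetric])
    also have "\<dots> = (\<Sum>\<tau> | \<tau> permutes insert z (S - {c}).
        - (moore_term ?N (insert z (S - {c})) \<tau> * M c z))"
      by (rule sum.cong) (auto intro!: moore_term_moved[OF S c])
    finally show "(\<Sum>\<sigma>\<in>?P c. moore_term M (insert z S) \<sigma>) =
        - (set_det ?N (insert z (S - {c})) * M c z)"
      by (simp add: set_det_def sum_distrib_right sum_negf)
  qed simp
  finally show ?thesis by (simp add: sum_negf)
qed

section \<open>Quaternions as pairs of complex numbers, and comparison of the two recursions\<close>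

text \<open>\<open>qpair z w\<close> is the quaternion \<open>z + w\<^bold>j\<close>.\<close>

definition qpair :: "complex \<Rightarrow> complex \<Rightarrow> quat" where
  "qpair z w = Quat (Re z) (Im z) (Re w) (Im w)"

lemma qpair_diff: "qpair a b - qpair c d = qpair (a - c) (b - d)"
  by (simp add: qpair_def minus_quat_def)

lemma qpair_mult: "qpair a b * qpair c d = qpair (a * c - b * cnj d) (a * d + b * cnj c)"
  by (simp add: qpair_def times_quat_def algebra_simps)

lemma qpair_sum: "(\<Sum>i\<in>I. qpair (f i) (g i)) = qpair (sum f I) (sum g I)"
  by (induction I rule: infinite_finite_induct)
    (simp_all add: qpair_def zero_quat_def plus_quat_def)

lemma qpair_1: "qpair 1 0 = 1"
  by (simp add: qpair_def one_quat_def)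

lemma quat_of_complex_qpair: "quat_of_complex z = qpair z 0"
  by (simp add: quat_of_complex_def qpair_def)

lemma of_nat_qpair: "of_nat k = qpair (of_nat k) 0"
  by (induction k) (simp_all add: qpair_def zero_quat_def one_quat_def plus_quat_def)

text \<open>The vertex \<open>z\<close> is a placeholder carrying row \<open>x\<close> and column
  \<open>y\<close> of \<open>M\<close>; thus \<open>x\<close> and \<open>y\<close> may themselves
  belong to the index set while \<open>z\<close> stays below it.\<close>

definition bordered :: "(nat \<Rightarrow> nat \<Rightarrow> quat) \<Rightarrow> nat \<Rightarrow> nat \<Rightarrow> nat \<Rightarrow> nat \<Rightarrow> nat \<Rightarrow> quat" where
  "bordered M z x y i j = M (if i = z then x else i) (if j = z then y else j)"

text \<open>Replacing column \<open>z\<close> by column \<open>c\<close> again gives a bordered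
  matrix, with \<open>c\<close> in place of \<open>y\<close>, so the expansion is a recursion within
  this family.\<close>

lemma set_det_bordered:
  assumes S: "finite S" "\<And>s. s \<in> S \<Longrightarrow> z < s"
  shows "set_det (bordered M z x y) (insert z S) = set_det M S * M x y
    - (\<Sum>c\<in>S. set_det (bordered M z x c) (insert z (S - {c})) * M c y)"
proof -
  have "set_det (bordered M z x y) S = set_det M S"
    by (rule set_det_cong) (use S in \<open>auto simp: bordered_def\<close>)
  moreover have "(\<lambda>i j. if j = z then bordered M z x y i c else bordered M z x y i j)
      = bordered M z x c" "bordered M z x y c z = M c y" if "c \<in> S" for c
    using S(2)[OF that] by (auto simp: bordered_def fun_eq_iff)
  ultimately show ?thesis
    by (simp add: set_det_insert_min[OF S]) (simp add: bordered_def)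
qed

text \<open>Both claims go through one induction on \<open>card S\<close>: the first for
  \<open>S\<close> follows from the second for \<open>S\<close> without its minimum, the second for
  \<open>S\<close> from the first for \<open>S\<close> and the second for each
  \<open>S - {c}\<close>.\<close>

lemma set_det_pf:
  fixes a :: "nat \<Rightarrow> nat \<Rightarrow> complex"
  assumes antisym: "\<And>A B. a A B = - a B A"
    and M: "\<And>l m. l < n \<Longrightarrow> m < n \<Longrightarrow> M l m = qpair (2 * a l (n + m)) (2 * a l m)"
    and a1: "\<And>l m. l < n \<Longrightarrow> m < n \<Longrightarrow> a (n + l) (n + m) = cnj (a l m)"
    and a2: "\<And>l m. l < n \<Longrightarrow> m < n \<Longrightarrow> a l (n + m) = cnj (a m (n + l))"
    and S: "finite S" "S \<subseteq> {..<n}"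
  shows "set_det M S = qpair (pf n a S) 0 \<and>
    (\<forall>z x y. (\<forall>s\<in>S. z < s) \<longrightarrow> x < n \<longrightarrow> y < n \<longrightarrow>
      set_det (bordered M z x y) (insert z S) = qpair (pf2 n a S x (n + y)) (pf2 n a S x y))"
  using S
proof (induction "card S" arbitrary: S rule: less_induct)
  case less
  note S = \<open>finite S\<close> \<open>S \<subseteq> {..<n}\<close>
  have smaller: "card (S - {c}) < card S" if "c \<in> S" for c
    using card_Diff1_less[OF S(1) that] .
  have det: "set_det M S = qpair (pf n a S) 0"
  proof (cases "S = {}")
    case True
    then show ?thesis by (simp add: set_det_empty pf_empty qpair_1)
  next
    case False
    \<comment> \<open>The minimum serves as its own border: with \<open>x = y = z\<close> the
      bordered matrix is \<open>M\<close>, and the second component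
      \<open>pf2 n a (S - {z}) z z\<close> vanishes.\<close>
    define z where "z = Min S"
    have z: "z \<in> S" "\<And>s. s \<in> S - {z} \<Longrightarrow> z < s"
      using S False by (auto simp: z_def intro: le_neq_trans)
    have "bordered M z z z = M" by (auto simp: bordered_def fun_eq_iff)
    moreover have "set_det (bordered M z z z) (insert z (S - {z})) =
        qpair (pf2 n a (S - {z}) z (n + z)) (pf2 n a (S - {z}) z z)"
      using less(1)[OF smaller[OF z(1)]] S z by (auto simp del: insert_Diff_single)
    ultimately show ?thesis
      using S z(1) pf_insert[of "S - {z}" z n a] by (simp add: pf2_same insert_absorb)
  qed
  moreover have "set_det (bordered M z x y) (insert z S) =
      qpair (pf2 n a S x (n + y)) (pf2 n a S x y)"
    if z: "\<forall>s\<in>S. z < s" and x: "x < n" and y: "y < n" for z x y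
  proof -
    let ?p = "\<lambda>c. pf2 n a (S - {c}) x"
    have "set_det (bordered M z x c) (insert z (S - {c})) * M c y =
      qpair (2 * a c (n + y) * ?p c (n + c) - cnj (2 * a c y) * ?p c c)
        (2 * a c y * ?p c (n + c) + cnj (2 * a c (n + y)) * ?p c c)" if c: "c \<in> S" for c
      using less(1)[OF smaller[OF c]] S c x y z
      by (auto simp: M subset_iff qpair_mult mult_ac)
    then have "set_det (bordered M z x y) (insert z S) =
        qpair (2 * a x (n + y) * pf n a S
            - (\<Sum>c\<in>S. 2 * a c (n + y) * ?p c (n + c) - cnj (2 * a c y) * ?p c c))
          (2 * a x y * pf n a S
            - (\<Sum>c\<in>S. 2 * a c y * ?p c (n + c) + cnj (2 * a c (n + y)) * ?p c c))"
      using z S x y by (simp add: set_det_bordered det M qpair_mult qpair_sum qpair_diff mult_ac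
          cong: sum.cong)
    \<comment> \<open>\<open>pf2_rec\<close> expands in the first argument, whereas the Moore
      expansion runs over the column; hence the arguments are swapped and row \<open>n + y\<close>
      is expanded. The conjugates from quaternion multiplication match through
      \<open>a1\<close>.\<close>
    also have "2 * a x (n + y) * pf n a S
        - (\<Sum>c\<in>S. 2 * a c (n + y) * ?p c (n + c) - cnj (2 * a c y) * ?p c c) = pf2 n a S x (n + y)"
    proof -
      have "a (n + y) c = - a c (n + y)" "a (n + y) (n + c) = - cnj (a c y)" if "c \<in> S" for c
        using antisym[of "n + y" c] antisym[of "n + y" "n + c"] a1[of c y] S that y by auto
      then have "(\<Sum>c\<in>S. 2 * a (n + y) c * ?p c (n + c) - 2 * a (n + y) (n + c) * ?p c c) =
          - (\<Sum>c\<in>S. 2 * a c (n + y) * ?p c (n + c) - cnj (2 * a c y) * ?p c c)"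
        by (subst sum_negf[symmetric]) (intro sum.cong; simp)
      then show ?thesis
        using pf2_swap[of S n a x "n + y"] pf2_rec[of S n "n + y" x a, OF S _ _ antisym] S x y
          antisym[of "n + y" x] by simp
    qed
    \<comment> \<open>The second component works likewise with row \<open>y\<close>, where
      \<open>a2\<close> supplies the conjugates.\<close>
    also have "2 * a x y * pf n a S
        - (\<Sum>c\<in>S. 2 * a c y * ?p c (n + c) + cnj (2 * a c (n + y)) * ?p c c) = pf2 n a S x y"
    proof -
      have "a y c = - a c y" "a y (n + c) = cnj (a c (n + y))" if "c \<in> S" for c
        using antisym[of y c] a2[of y c] S that y by auto
      then have "(\<Sum>c\<in>S. 2 * a y c * ?p c (n + c) - 2 * a y (n + c) * ?p c c) =
          - (\<Sum>c\<in>S. 2 * a c y * ?p c (n + c) + cnj (2 * a c (n + y)) * ?p c c)"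
        by (subst sum_negf[symmetric]) (intro sum.cong; simp)
      then show ?thesis
        using pf2_swap[of S n a x y] pf2_rec[of S n y x a, OF S _ _ antisym] S x y
          antisym[of y x] by simp
    qed
    finally show ?thesis .
  qed
  ultimately show ?case by blast
qed

section \<open>Powers of the 2-form\<close>

lemma wedge_cong:
  "(\<And>I. I \<subseteq> K \<Longrightarrow> F I = G I) \<Longrightarrow> wedge \<alpha> F K = wedge \<alpha> G K"
  by (simp add: wedge_def)

text \<open>The sum then runs over the infinite set \<open>Pow K\<close> and takes the default value
  0. Exterior multiplication is therefore compared with \<open>wedge\<close> at finite
  \<open>K\<close> only.\<close>

lemma wedge_infinite: "infinite K \<Longrightarrow> wedge \<alpha> \<beta> K = 0"
  by (simp add: wedge_def)

text \<open>The new element \<open>x\<close> adds one inversion for every \<open>j\<close> in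
  \<open>J\<close> below it.\<close>

lemma shuffle_sign_insert:
  assumes "finite I" "finite J" "x \<notin> I"
  shows "shuffle_sign (insert x I) J = prefix_sign x J * shuffle_sign I J"
proof -
  let ?P = "\<lambda>I. {(i, j). i \<in> I \<and> j \<in> J \<and> j < i}"
  have "finite (?P I)" by (rule finite_subset[of _ "I \<times> J"]) (use assms in auto)
  moreover have "?P (insert x I) = ?P I \<union> Pair x ` {j \<in> J. j < x}" by auto
  moreover have "?P I \<inter> Pair x ` {j \<in> J. j < x} = {}" using assms by auto
  ultimately have "card (?P (insert x I)) = card (?P I) + card {j \<in> J. j < x}"
    using assms by (simp add: card_Un_disjoint card_image inj_on_def)
  then show ?thesis by (simp add: shuffle_sign_def prefix_sign_def power_add)
qed

lemma shuffle_sign_empty: "shuffle_sign {} J = 1"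
  by (simp add: shuffle_sign_def)

lemma wedge_single:
  assumes "finite K" "\<And>I. I \<subseteq> K \<Longrightarrow> I \<noteq> I0 \<Longrightarrow> \<alpha> I = 0"
  shows "wedge \<alpha> F K = (if I0 \<subseteq> K then shuffle_sign I0 (K - I0) * \<alpha> I0 * F (K - I0) else 0)"
proof -
  have "wedge \<alpha> F K = (\<Sum>I\<in>Pow K. if I = I0 then shuffle_sign I0 (K - I0) * \<alpha> I0 * F (K - I0) else 0)"
    unfolding wedge_def by (rule sum.cong) (use assms in auto)
  then show ?thesis using assms by simp
qed

lemma wedge_omega:
  assumes "finite K" shows "wedge (omega A) F K = omega_mult A F K"
  using assms by (subst wedge_single[of K "{A}"])
    (auto simp: omega_def omega_mult_def shuffle_sign_insert shuffle_sign_empty prefix_sign_remove)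

text \<open>The instance of associativity that powers of a 2-form require. It is direct because
  \<open>wedge (omega A) (omega B)\<close> lives on the single set \<open>{A, B}\<close>.\<close>

lemma wedge_omega_omega:
  assumes "finite K" shows "wedge (wedge (omega A) (omega B)) F K = omega_mult A (omega_mult B F) K"
proof -
  have *: "wedge (omega A) (omega B) I = (if A \<noteq> B \<and> I = {A, B} then prefix_sign A {B} else 0)"
    if "I \<subseteq> K" for I
  proof -
    have "finite I" using that assms finite_subset by blast
    moreover have "A \<in> I \<and> I - {A} = {B} \<longleftrightarrow> A \<noteq> B \<and> I = {A, B}" by auto
    ultimately show ?thesis
      by (auto simp: wedge_omega omega_mult_def omega_def prefix_sign_insert)
  qed
  show ?thesis
  proof (cases "A = B")
    case True
    have "wedge (wedge (omega A) (omega B)) F K = 0"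
      unfolding wedge_def[of "wedge _ _"] by (rule sum.neutral) (use * True in auto)
    then show ?thesis using True by (simp add: omega_mult_def)
  next
    case False
    have sg0: "prefix_sign x {} = 1" for x by (simp add: prefix_sign_def)
    show ?thesis
    proof (cases "{A, B} \<subseteq> K")
      case True
      define J where "J = K - {A, B}"
      have J: "A \<notin> J" "B \<notin> J" "finite J" "K = insert A (insert B J)"
        using True assms by (auto simp: J_def)
      then have "K - {A} = insert B J" "K - {A} - {B} = J" using False by auto
      then have "omega_mult A (omega_mult B F) K = prefix_sign A K * (prefix_sign B J * F J)"
        using J by (simp add: omega_mult_def prefix_sign_insert)
      moreover have "prefix_sign A K = prefix_sign A {B} * prefix_sign A J"
        using J False by (simp add: prefix_sign_insert sg0)
      moreover have "wedge (wedge (omega A) (omega B)) F K =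
          prefix_sign A J * prefix_sign B J * prefix_sign A {B} * F J"
        using True False J(3) assms
        by (subst wedge_single[of K "{A, B}"])
          (auto simp: * shuffle_sign_insert shuffle_sign_empty J_def)
      ultimately show ?thesis by (simp add: mult_ac)
    next
      case False
      then show ?thesis
        using assms by (subst wedge_single[of K "{A, B}"]) (auto simp: * omega_mult_def)
    qed
  qed
qed

lemma wedge_Delta:
  assumes "finite K"
  shows "wedge (Delta n u p) F K = wedge2 (2 * n) (\<lambda>A B. DeltaAB n A B u p) F K"
proof -
  have "wedge (Delta n u p) F K = (\<Sum>I\<in>Pow K. \<Sum>A<2*n. \<Sum>B<2*n. DeltaAB n A B u p *
      (shuffle_sign I (K - I) * wedge (omega A) (omega B) I * F (K - I)))"
    by (simp add: wedge_def[of "Delta n u p"] Delta_def sum_distrib_left sum_distrib_right mult_ac)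
  also have "\<dots> = (\<Sum>A<2*n. \<Sum>B<2*n. DeltaAB n A B u p * wedge (wedge (omega A) (omega B)) F K)"
    unfolding wedge_def[of "wedge _ _"] sum_distrib_left
    by (subst sum.swap) (auto intro!: sum.cong sum.swap)
  finally show ?thesis using assms by (simp add: wedge_omega_omega wedge2_def)
qed

lemma wedge_pow_Delta:
  assumes "finite K"
  shows "wedge_pow (Delta n u p) k K = (wedge2 (2 * n) (\<lambda>A B. DeltaAB n A B u p) ^^ k) form_one K"
  using assms
proof (induction k arbitrary: K)
  case (Suc k)
  let ?L = "wedge2 (2 * n) (\<lambda>A B. DeltaAB n A B u p)"
  have "wedge (Delta n u p) (wedge_pow (Delta n u p) k) K = wedge (Delta n u p) ((?L ^^ k) form_one) K"
    by (rule wedge_cong) (use Suc finite_subset in blast)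
  then show ?case using Suc.prems by (simp add: wedge_Delta)
qed simp

lemma wedge_pow_infinite: "infinite K \<Longrightarrow> wedge_pow \<alpha> k K = 0"
  by (cases k) (auto simp: wedge_infinite form_one_def)

lemma foldr_wedge_omega:
  "finite K \<Longrightarrow> foldr wedge (map omega xs) form_one K = foldr omega_mult xs form_one K"
proof (induction xs arbitrary: K)
  case (Cons x xs)
  then show ?case by (simp add: wedge_omega omega_mult_def)
qed simp

lemma foldr_wedge_infinite: "infinite K \<Longrightarrow> foldr wedge xs form_one K = 0"
  by (cases xs) (auto simp: wedge_infinite form_one_def)

lemma foldr_omega_mult_support: "foldr omega_mult xs form_one K \<noteq> 0 \<Longrightarrow> K = set xs"
proof (induction xs arbitrary: K)
  case (Cons x xs)
  then have "x \<in> K" "K - {x} = set xs" by (auto simp: omega_mult_def split: if_splits)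
  then show ?case by auto
qed (simp add: form_one_def split: if_splits)

lemma wedge2_pow_support:
  "(wedge2 N a ^^ k) form_one K \<noteq> 0 \<Longrightarrow> K \<subseteq> {..<N} \<and> card K = 2 * k"
proof (induction k arbitrary: K)
  case 0
  then show ?case by (simp add: form_one_def split: if_splits)
next
  case (Suc k)
  let ?F = "(wedge2 N a ^^ k) form_one"
  from Suc.prems have "wedge2 N a ?F K \<noteq> 0" by simp
  then have "(\<Sum>A<N. \<Sum>B<N. a A B * omega_mult A (omega_mult B ?F) K) \<noteq> 0"
    by (simp add: wedge2_def[of N a ?F])
  then obtain A where A: "A < N" "(\<Sum>B<N. a A B * omega_mult A (omega_mult B ?F) K) \<noteq> 0"
    by (metis (no_types, lifting) lessThan_iff sum.neutral)
  then obtain B where B: "B < N" "a A B * omega_mult A (omega_mult B ?F) K \<noteq> 0"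
    by (metis (no_types, lifting) lessThan_iff sum.neutral)
  then have AB: "A \<in> K" "B \<in> K - {A}" "?F (K - {A} - {B}) \<noteq> 0"
    by (auto simp: omega_mult_def split: if_splits)
  from Suc.IH[OF AB(3)] have *: "K - {A} - {B} \<subseteq> {..<N}" "card (K - {A} - {B}) = 2 * k" by auto
  then have "finite (K - {A} - {B})" using finite_subset by blast
  then have "finite K" by simp
  then have "card K = Suc (Suc (card (K - {A} - {B})))"
    using AB by (metis card.remove finite_Diff)
  then show ?case using * A B AB by auto
qed

section \<open>The top-degree coefficient\<close>

definition omega_list :: "nat \<Rightarrow> nat list \<Rightarrow> nat list" where
  "omega_list n ls = concat (map (\<lambda>l. [l, n + l]) ls)"

lemma contract_pairs_omega_list:
  assumes "distinct ls" "set ls \<subseteq> {..<n}"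
  shows "contract_pairs n (set ls) (foldr omega_mult (omega_list n ls) form_one) {} = 1"
  using assms
proof (induction ls)
  case (Cons l ls)
  let ?G = "foldr omega_mult (omega_list n ls) form_one"
  have "contract_pairs n (set (l # ls)) (foldr omega_mult (omega_list n (l # ls)) form_one) {} =
      contract_pairs n (set (l # ls) - {l}) (contract (n + l) (omega_mult (n + l) ?G)) {}"
    using Cons.prems contract_pairs_omega_mult_low[of "set (l # ls)" n l "omega_mult (n + l) ?G"]
    by (simp add: omega_list_def)
  also have "set (l # ls) - {l} = set ls" using Cons.prems by auto
  also have "contract_pairs n (set ls) (contract (n + l) (omega_mult (n + l) ?G)) {} = contract_pairs n (set ls) ?G {}
      - contract_pairs n (set ls) (omega_mult (n + l) (contract (n + l) ?G)) {}"
    by (simp add: contract_omega_mult_same form_linear_diff[OF form_linear_contract_pairs])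
  also have "contract_pairs n (set ls) (omega_mult (n + l) (contract (n + l) ?G)) {} = 0"
    using Cons.prems by (intro contract_pairs_omega_mult_0) auto
  finally show ?case using Cons by simp
qed (simp add: omega_list_def form_one_def)

lemma set_omega_list: "set (omega_list n [0..<n]) = {..<2 * n}"
proof (intro equalityI subsetI)
  fix b assume "b \<in> {..<2 * n}"
  then have "b < n \<or> (b - n < n \<and> b = n + (b - n))" by auto
  then show "b \<in> set (omega_list n [0..<n])"
    by (auto simp: omega_list_def)
qed (auto simp: omega_list_def)

text \<open>Both forms are supported on the full index set alone, hence proportional; contracting
  all pairs determines the ratio.\<close>

lemma wedge2_pow_top:
  "(wedge2 (2 * n) a ^^ n) form_one K =
    fact n * pf n a {..<n} * foldr omega_mult (omega_list n [0..<n]) form_one K"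
proof -
  let ?F = "(wedge2 (2 * n) a ^^ n) form_one" and ?O = "foldr omega_mult (omega_list n [0..<n]) form_one"
  let ?C = "contract_pairs n {..<n}" and ?T = "{..<2 * n}"
  have lin: "form_linear ?C" by (simp add: form_linear_contract_pairs)
  have F0: "?F K = 0" if "K \<noteq> ?T" for K
    using wedge2_pow_support[where N = "2 * n" and a = a and k = n and K = K] that
      card_subset_eq[of ?T K] by auto
  have O0: "?O K = 0" if "K \<noteq> ?T" for K
    using foldr_omega_mult_support[of "omega_list n [0..<n]" K] that by (auto simp: set_omega_list)
  have O1: "?C ?O {} = 1"
    using contract_pairs_omega_list[of "[0..<n]" n] by (simp add: atLeast0LessThan)
  \<comment> \<open>A vanishing coefficient would make the whole form zero, against its contraction
    being 1.\<close>
  have "?O ?T \<noteq> 0"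
  proof
    assume "?O ?T = 0"
    then have "?O = (\<lambda>K. 0)" using O0 by (intro HOL.ext) metis
    then show False using O1 form_linear_zero[OF lin] by simp
  qed
  define r where "r = ?F ?T / ?O ?T"
  have F: "?F = (\<lambda>K. r * ?O K)"
  proof
    show "?F K = r * ?O K" for K
      using F0[of K] O0[of K] \<open>?O ?T \<noteq> 0\<close> by (cases "K = ?T") (auto simp: r_def)
  qed
  have "pf n a {..<n} = 1 / fact n * ?C ?F {}"
    unfolding pf_def div_pow_def form_linear_scale[OF lin] by simp
  also have "?C ?F {} = r"
    unfolding F form_linear_scale[OF lin] O1 by simp
  finally show ?thesis by (simp add: F)
qed

section \<open>Second-order horizontal derivatives\<close>

text \<open>The mean value theorem is applied first in \<open>s\<close> to the difference of two
  slices, then in \<open>t\<close> to the resulting difference of derivatives.\<close>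

lemma mixed_second_difference:
  fixes f fs fts :: "real \<Rightarrow> real \<Rightarrow> real"
  assumes h: "0 < h"
    and 1: "\<And>s t. ((\<lambda>s. f s t) has_real_derivative fs s t) (at s)"
    and 2: "\<And>s t. ((\<lambda>t. fs s t) has_real_derivative fts s t) (at t)"
  shows "\<exists>s t. x < s \<and> s < x + h \<and> y < t \<and> t < y + h \<and>
    f (x + h) (y + h) - f (x + h) y - f x (y + h) + f x y = h * h * fts s t"
proof -
  have d: "((\<lambda>s. f s (y + h) - f s y) has_real_derivative (fs s (y + h) - fs s y)) (at s)" for s
    by (intro derivative_intros 1)
  obtain s where s: "x < s" "s < x + h"
    "f (x + h) (y + h) - f (x + h) y - (f x (y + h) - f x y) = h * (fs s (y + h) - fs s y)"
    using MVT2[of x "x + h", OF _ d] h by auto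
  obtain t where t: "y < t" "t < y + h" "fs s (y + h) - fs s y = h * fts s t"
    using MVT2[of y "y + h", OF _ 2] h by auto
  show ?thesis using s t by (intro exI[of _ s] exI[of _ t]) (simp add: algebra_simps)
qed

text \<open>Schwarz's theorem: on squares shrinking to \<open>(x, y)\<close> the second difference
  equals the area times a value of \<open>g1\<close> and also times a value of \<open>g2\<close>;
  continuity passes to the limit.\<close>

lemma mixed_partials_equal:
  fixes f fs ft g1 g2 :: "real \<Rightarrow> real \<Rightarrow> real"
  assumes 1: "\<And>s t. ((\<lambda>s. f s t) has_real_derivative fs s t) (at s)"
      "\<And>s t. ((\<lambda>t. fs s t) has_real_derivative g1 s t) (at t)"
    and 2: "\<And>s t. ((\<lambda>t. f s t) has_real_derivative ft s t) (at t)"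
      "\<And>s t. ((\<lambda>s. ft s t) has_real_derivative g2 s t) (at s)"
    and c: "isCont (\<lambda>q. g1 (fst q) (snd q)) (x, y)" "isCont (\<lambda>q. g2 (fst q) (snd q)) (x, y)"
  shows "g1 x y = g2 x y"
proof -
  define h where "h = (\<lambda>n. 1 / real (Suc n))"
  have h: "h n > 0" for n by (simp add: h_def)
  have h0: "h \<longlonglongrightarrow> 0"
    unfolding h_def using LIMSEQ_inverse_real_of_nat by (simp add: inverse_eq_divide)
  have "\<exists>s t s' t'. x < s \<and> s < x + h n \<and> y < t \<and> t < y + h n \<and>
      x < s' \<and> s' < x + h n \<and> y < t' \<and> t' < y + h n \<and> g1 s t = g2 s' t'" for n
  proof -
    obtain s t where a: "x < s" "s < x + h n" "y < t" "t < y + h n"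
      "f (x + h n) (y + h n) - f (x + h n) y - f x (y + h n) + f x y = h n * h n * g1 s t"
      using mixed_second_difference[OF h 1] by blast
    \<comment> \<open>The same second difference with the roles of the two variables
      exchanged.\<close>
    obtain t' s' where b: "y < t'" "t' < y + h n" "x < s'" "s' < x + h n"
      "f (x + h n) (y + h n) - f x (y + h n) - f (x + h n) y + f x y = h n * h n * g2 s' t'"
      using mixed_second_difference[of "h n" "\<lambda>t s. f s t" "\<lambda>t s. ft s t" "\<lambda>t s. g2 s t" y x, OF h 2]
      by blast
    have "h n * h n * g1 s t = h n * h n * g2 s' t'" using a(5) b(5) by linarith
    then have "g1 s t = g2 s' t'" using h[of n] by simp
    then show ?thesis using a b by blast
  qed
  then obtain s t s' t' where p: "\<And>n.
      x < s n \<and> s n < x + h n \<and> y < t n \<and> t n < y + h n \<and>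
      x < s' n \<and> s' n < x + h n \<and> y < t' n \<and> t' n < y + h n \<and> g1 (s n) (t n) = g2 (s' n) (t' n)"
    by metis
  have lim: "r \<longlonglongrightarrow> a" if "\<And>n. a < r n \<and> r n < a + h n" for r and a :: real
  proof (rule real_tendsto_sandwich)
    show "(\<lambda>n. a) \<longlonglongrightarrow> a" "(\<lambda>n. a + h n) \<longlonglongrightarrow> a"
      using tendsto_add[OF tendsto_const h0, of a] by simp_all
  qed (use that less_imp_le in \<open>auto intro!: always_eventually\<close>)
  have "(\<lambda>n. (s n, t n)) \<longlonglongrightarrow> (x, y)" "(\<lambda>n. (s' n, t' n)) \<longlonglongrightarrow> (x, y)"
    by (intro tendsto_Pair lim; use p in blast)+
  then have "(\<lambda>n. g1 (s n) (t n)) \<longlonglongrightarrow> g1 x y" "(\<lambda>n. g2 (s' n) (t' n)) \<longlonglongrightarrow> g2 x y"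
    using isCont_tendsto_compose[OF c(1)] isCont_tendsto_compose[OF c(2)] by fastforce+
  then show ?thesis using p LIMSEQ_unique by simp
qed

text \<open>Starting from the point \<open>p(i := x)\<close> transfers differentiability from
  \<open>p i\<close> to every \<open>x\<close> on the coordinate line.\<close>

lemma pd_DERIV:
  assumes "\<And>p. (\<lambda>s. f (p(i := s))) differentiable (at (p i))"
  shows "((\<lambda>s. f (p(i := s))) has_real_derivative pd i f (p(i := x))) (at x)"
  using assms[of "p(i := x)"] by (simp add: pd_def DERIV_deriv_iff_real_differentiable)

text \<open>\<open>bracket_coeff j k\<close> is the derivative along \<open>x\<^sub>j\<close> of the \<open>\<partial>\<^sub>t\<close>-coefficient of \<open>X\<^sub>k\<close>, the only
  part of \<open>X\<^sub>j X\<^sub>k u\<close> that is not symmetric in \<open>j\<close> and \<open>k\<close>.\<close>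

definition bracket_coeff :: "nat \<Rightarrow> nat \<Rightarrow> real" where
  "bracket_coeff j k = (if odd k then (if j = k + 1 then - 2 else 0) else (if k = j + 1 then 2 else 0))"

definition XX_sym :: "((nat \<Rightarrow> real) \<Rightarrow> real) \<Rightarrow> nat \<Rightarrow> nat \<Rightarrow> (nat \<Rightarrow> real) \<Rightarrow> real" where
  "XX_sym u j k p = (let g = (\<lambda>j. if odd j then - 2 * p (j + 1) else 2 * p (j - 1)) in
     pd j (pd k u) p + g k * pd j (pd 0 u) p + g j * pd 0 (pd k u) p + g j * g k * pd 0 (pd 0 u) p)"

context
  fixes n :: nat and u :: "(nat \<Rightarrow> real) \<Rightarrow> real"
  assumes u: "C2_on_H n u"
begin

lemma DERIV_u: "i \<le> 4 * n \<Longrightarrow>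
    ((\<lambda>s. u (p(i := s))) has_real_derivative pd i u (p(i := x))) (at x)"
  using u by (intro pd_DERIV) (simp add: C2_on_H_def)

lemma DERIV_pd_u: "i \<le> 4 * n \<Longrightarrow> j \<le> 4 * n \<Longrightarrow>
    ((\<lambda>s. pd i u (p(j := s))) has_real_derivative pd j (pd i u) (p(j := x))) (at x)"
  using u by (intro pd_DERIV) (simp add: C2_on_H_def)

lemma pd_commute:
  assumes ij: "i \<le> 4 * n" "j \<le> 4 * n"
  shows "pd j (pd i u) p = pd i (pd j u) p"
proof (cases "i = j")
  case False
  let ?q = "\<lambda>s t. p(i := s, j := t)"
  have q: "p(j := t, i := s) = ?q s t" for s t using False by (simp add: fun_upd_twist)
  \<comment> \<open>Points are functions with the product topology, so continuity of the coordinate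
    plane is checked coordinatewise.\<close>
  have "continuous_on UNIV (\<lambda>r. ?q (fst r) (snd r))"
  proof (rule continuous_on_coordinatewise_then_product)
    fix l show "continuous_on UNIV (\<lambda>r. ?q (fst r) (snd r) l)"
      by (cases "l = j"; cases "l = i") (auto intro!: continuous_intros)
  qed
  then have cont: "isCont (\<lambda>r. F (?q (fst r) (snd r))) (p i, p j)"
    if "continuous_on UNIV F" for F :: "(nat \<Rightarrow> real) \<Rightarrow> real"
    using continuous_on_compose2[OF that, of UNIV "\<lambda>r. ?q (fst r) (snd r)"]
    by (simp add: continuous_on_eq_continuous_at)
  have "pd j (pd i u) (?q (p i) (p j)) = pd i (pd j u) (?q (p i) (p j))"
  proof (rule mixed_partials_equal[where f = "\<lambda>s t. u (?q s t)"
        and fs = "\<lambda>s t. pd i u (?q s t)" and ft = "\<lambda>s t. pd j u (?q s t)"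
        and ?g1.0 = "\<lambda>s t. pd j (pd i u) (?q s t)"
        and ?g2.0 = "\<lambda>s t. pd i (pd j u) (?q s t)"])
    show "((\<lambda>s. u (?q s t)) has_real_derivative pd i u (?q s t)) (at s)" for s t
      using DERIV_u[OF ij(1), of "p(j := t)"] by (simp add: q)
    show "((\<lambda>s. pd j u (?q s t)) has_real_derivative pd i (pd j u) (?q s t)) (at s)" for s t
      using DERIV_pd_u[OF ij(2,1), of "p(j := t)"] by (simp add: q)
    show "isCont (\<lambda>r. pd j (pd i u) (?q (fst r) (snd r))) (p i, p j)"
      "isCont (\<lambda>r. pd i (pd j u) (?q (fst r) (snd r))) (p i, p j)"
      using u ij by (auto intro!: cont simp: C2_on_H_def)
  qed (use DERIV_u DERIV_pd_u ij in auto)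
  then show ?thesis by simp
qed simp

lemma XX_sym_commute: "j \<le> 4 * n \<Longrightarrow> k \<le> 4 * n \<Longrightarrow> XX_sym u j k p = XX_sym u k j p"
  using pd_commute[of j k] pd_commute[of 0 j] pd_commute[of 0 k]
  by (simp add: XX_sym_def Let_def)

lemma XX_XX:
  assumes j: "1 \<le> j" "j \<le> 4 * n" and k: "1 \<le> k" "k \<le> 4 * n"
  shows "XX j (XX k u) p = XX_sym u j k p + bracket_coeff j k * pd 0 u p"
proof -
  let ?g = "\<lambda>k p. if odd k then - 2 * p (k + 1) else 2 * p (k - 1) :: real"
  have D: "pd i (XX k u) p = pd i (pd k u) p + ?g k p * pd i (pd 0 u) p
      + bracket_coeff i k * pd 0 u p" if i: "i \<le> 4 * n" for i
  proof -
    have g: "((\<lambda>s. ?g k (p(i := s))) has_real_derivative bracket_coeff i k) (at (p i))"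
    proof -
      \<comment> \<open>Truncated subtraction would also give \<open>k - 1 = i\<close> for
        \<open>k = i = 0\<close>, which \<open>1 \<le> k\<close> excludes.\<close>
      have "k - 1 = i \<longleftrightarrow> k = i + 1" using k by auto
      then show ?thesis
        by (auto simp: bracket_coeff_def intro!: derivative_eq_intros)
    qed
    have "((\<lambda>s. XX k u (p(i := s))) has_real_derivative
       pd i (pd k u) p + (?g k p * pd i (pd 0 u) p + bracket_coeff i k * pd 0 u p)) (at (p i))"
      using DERIV_add[OF DERIV_pd_u[OF k(2) i, of p "p i"]
          DERIV_mult'[OF g DERIV_pd_u[OF le0 i, of p "p i"]]]
      unfolding XX_def by (simp only: fun_upd_triv)
    then show ?thesis by (simp add: pd_def[of i "XX k u"] DERIV_imp_deriv)
  qed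
  \<comment> \<open>The coefficients of \<open>X_k\<close> do not depend on \<open>t\<close>, which
    is coordinate 0.\<close>
  have "bracket_coeff 0 k = 0" using k by (auto simp: bracket_coeff_def)
  then show ?thesis
    unfolding XX_def[of j] by (simp add: D[OF j(2)] D[OF le0] XX_sym_def Let_def algebra_simps)
qed

end

section \<open>Entries of the 2-form and of the quaternionic matrix in blocks of four\<close>

definition XX_block :: "((nat \<Rightarrow> real) \<Rightarrow> real) \<Rightarrow> (nat \<Rightarrow> real) \<Rightarrow> nat \<Rightarrow> nat \<Rightarrow> nat \<Rightarrow> nat \<Rightarrow> real" where
  "XX_block u p l a m b = XX (4 * l + 1 + a) (XX (4 * m + 1 + b) u) p"

lemma bracket_coeff_diff: "bracket_coeff k j - bracket_coeff j k =
    (if odd j \<and> k = j + 1 then - 4 else if odd k \<and> j = k + 1 then 4 else 0)"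
  by (auto simp: bracket_coeff_def)

lemma odd_successor_iff:
  fixes l m a b :: nat
  assumes "a < 4" "b < 4"
  shows "odd (4 * l + 1 + a) \<and> 4 * m + 1 + b = 4 * l + 1 + a + 1 \<longleftrightarrow>
    l = m \<and> (a, b) \<in> {(0, 1), (2, 3)}"
proof
  assume *: "odd (4 * l + 1 + a) \<and> 4 * m + 1 + b = 4 * l + 1 + a + 1"
  then have "a \<noteq> 1" "a \<noteq> 3" by auto
  then have a: "a = 0 \<or> a = 2" using assms by linarith
  \<comment> \<open>As \<open>a\<close> is 0 or 2, the successor stays within the same block of
    four, and division by 4 recovers the block.\<close>
  then have "(4 * l + (a + 1)) div 4 = l" by auto
  moreover have "(4 * m + b) div 4 = m" using assms by simp
  moreover have "4 * m + b = 4 * l + (a + 1)" using * by simp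
  ultimately have "l = m" "b = a + 1" by auto
  then show "l = m \<and> (a, b) \<in> {(0, 1), (2, 3)}" using a by auto
qed auto

text \<open>The symmetric parts cancel, leaving the commutator \<open>4 * pd 0 u p\<close> up to
  sign. It occurs only for the pairs \<open>(X_{4l+1}, X_{4l+2})\<close> and
  \<open>(X_{4l+3}, X_{4l+4})\<close> of one block.\<close>

lemma XX_block_commute:
  assumes u: "C2_on_H n u" and lm: "l < n" "m < n" and ab: "a < 4" "b < 4"
  shows "XX_block u p m b l a = XX_block u p l a m b + (if l \<noteq> m then 0
    else if (a, b) \<in> {(0, 1), (2, 3)} then - 4 * pd 0 u p
    else if (b, a) \<in> {(0, 1), (2, 3)} then 4 * pd 0 u p else 0)"
proof -
  let ?j = "4 * l + 1 + a" and ?k = "4 * m + 1 + b"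
  have j: "1 \<le> ?j" "?j \<le> 4 * n" and k: "1 \<le> ?k" "?k \<le> 4 * n" using lm ab by auto
  have "XX_block u p m b l a - XX_block u p l a m b = (bracket_coeff ?k ?j - bracket_coeff ?j ?k) * pd 0 u p"
    using XX_sym_commute[OF u j(2) k(2)] unfolding XX_block_def XX_XX[OF u j k] XX_XX[OF u k j]
    by (simp add: algebra_simps)
  then have "XX_block u p m b l a =
      XX_block u p l a m b + (bracket_coeff ?k ?j - bracket_coeff ?j ?k) * pd 0 u p"
    by linarith
  also have "(bracket_coeff ?k ?j - bracket_coeff ?j ?k) * pd 0 u p = (if l \<noteq> m then 0
    else if (a, b) \<in> {(0, 1), (2, 3)} then - 4 * pd 0 u p
    else if (b, a) \<in> {(0, 1), (2, 3)} then 4 * pd 0 u p else 0)"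
    unfolding bracket_coeff_diff odd_successor_iff[OF ab] odd_successor_iff[OF ab(2,1)]
    by (cases "l = m"; cases "(a, b) \<in> {(0, 1), (2, 3)}"; cases "(b, a) \<in> {(0, 1), (2, 3)}")
      (simp_all only: if_True if_False simp_thms not_True_eq_False not_False_eq_True mult_zero_left, auto)
  finally show ?thesis .
qed

text \<open>The arguments keep the form \<open>4*l+1+a\<close> so that they match
  \<open>XX_block\<close>.\<close>

lemma sum_zc:
  fixes f :: "nat \<Rightarrow> complex"
  assumes "l < n"
  shows "(\<Sum>j\<in>{1..4*n}. zc n l 0 j * f j) = f (4*l+1+0) + \<i> * f (4*l+1+1)"
    and "(\<Sum>j\<in>{1..4*n}. zc n l 1 j * f j) = - f (4*l+1+2) - \<i> * f (4*l+1+3)"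
    and "(\<Sum>j\<in>{1..4*n}. zc n (n + l) 0 j * f j) = f (4*l+1+2) - \<i> * f (4*l+1+3)"
    and "(\<Sum>j\<in>{1..4*n}. zc n (n + l) 1 j * f j) = f (4*l+1+0) - \<i> * f (4*l+1+1)"
proof -
  have two: "(\<Sum>j\<in>{1..4*n}. g j * f j) = c * f r + d * f s"
    if "\<And>j. g j = (if j = r then c else if j = s then d else 0)" "r \<noteq> s"
      "r \<in> {1..4*n}" "s \<in> {1..4*n}" for g c d r s
  proof -
    have "(\<Sum>j\<in>{1..4*n}. g j * f j) =
        (\<Sum>j\<in>{1..4*n}. (if j = r then c * f j else 0) + (if j = s then d * f j else 0))"
      using that(1,2) by (intro sum.cong) auto
    then show ?thesis using that(3,4) by (simp add: sum.distrib)
  qed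
  show "(\<Sum>j\<in>{1..4*n}. zc n l 0 j * f j) = f (4*l+1+0) + \<i> * f (4*l+1+1)"
    using assms by (subst two[of _ "4*l+1" 1 "4*l+2" \<i>]) (auto simp: zc_def)
  show "(\<Sum>j\<in>{1..4*n}. zc n l 1 j * f j) = - f (4*l+1+2) - \<i> * f (4*l+1+3)"
    using assms by (subst two[of _ "4*l+3" "-1" "4*l+4" "-\<i>"]) (auto simp: zc_def numeral_eq_Suc)
  show "(\<Sum>j\<in>{1..4*n}. zc n (n + l) 0 j * f j) = f (4*l+1+2) - \<i> * f (4*l+1+3)"
    using assms by (subst two[of _ "4*l+3" "1" "4*l+4" "-\<i>"]) (auto simp: zc_def numeral_eq_Suc)
  show "(\<Sum>j\<in>{1..4*n}. zc n (n + l) 1 j * f j) = f (4*l+1+0) - \<i> * f (4*l+1+1)"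
    using assms by (subst two[of _ "4*l+1" "1" "4*l+2" "-\<i>"]) (auto simp: zc_def)
qed

lemma ZZ_iterated: "ZZ n A B u p = (\<Sum>j\<in>{1..4*n}. zc n A 0 j *
    (\<Sum>k\<in>{1..4*n}. zc n B 1 k * complex_of_real (XX j (XX k u) p)))"
  by (simp add: ZZ_def sum_distrib_left mult.assoc)

lemma ZZ_XX_block:
  fixes u :: "(nat \<Rightarrow> real) \<Rightarrow> real" and p :: "nat \<Rightarrow> real"
  assumes "l < n" "m < n"
  defines "e \<equiv> \<lambda>a b. complex_of_real (XX_block u p l a m b)"
  shows "ZZ n l (n + m) u p = e 0 0 + e 1 1 + \<i> * (e 1 0 - e 0 1)"
    and "ZZ n l m u p = - e 0 2 + e 1 3 - \<i> * (e 0 3 + e 1 2)"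
    and "ZZ n (n + l) m u p = - e 2 2 - e 3 3 + \<i> * (e 3 2 - e 2 3)"
    and "ZZ n (n + l) (n + m) u p = e 2 0 - e 3 1 - \<i> * (e 3 0 + e 2 1)"
  unfolding ZZ_iterated sum_zc[OF assms(1)] sum_zc[OF assms(2)] e_def XX_block_def
  by (simp_all add: complex_eq_iff)

lemma sum_lessThan_4: "sum f {..<4 :: nat} = f 0 + f 1 + f 2 + f 3"
  by (simp add: eval_nat_numeral)

lemma QQmat_XX_block: "QQmat u p l m = (let e = XX_block u p l; d = (if l = m then 8 * pd 0 u p else 0) in
   Quat (e 0 m 0 + e 1 m 1 + e 2 m 2 + e 3 m 3)
     (e 1 m 0 - e 0 m 1 + e 3 m 2 - e 2 m 3 + d)
     (e 2 m 0 - e 0 m 2 + e 1 m 3 - e 3 m 1)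
     (e 3 m 0 - e 0 m 3 + e 2 m 1 - e 1 m 2))"
  unfolding QQmat_def XX_block_def[symmetric] sum_lessThan_4
  by (simp add: Let_def qunit_def qcnj_def qreal_def times_quat_def plus_quat_def zero_quat_def)

lemma DeltaAB_antisym: "DeltaAB n A B u p = - DeltaAB n B A u p"
  by (simp add: DeltaAB_def field_simps)

text \<open>In \<open>2 * DeltaAB n l (n + m) u p\<close> the second product has its fields in the
  opposite order. For \<open>l = m\<close>, exchanging positions 2 and 3 in its two mixed terms
  gives \<open>4 * pd 0 u p\<close> each; together they form the summand \<open>8 * pd 0 u p\<close>
  in the \<i>-component of \<open>QQmat\<close>.\<close>

lemma DeltaAB_entries:
  assumes u: "C2_on_H n u" and lm: "l < n" "m < n"
  shows "QQmat u p l m = qpair (2 * DeltaAB n l (n + m) u p) (2 * DeltaAB n l m u p)"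
    and "DeltaAB n (n + l) (n + m) u p = cnj (DeltaAB n l m u p)"
    and "DeltaAB n l (n + m) u p = cnj (DeltaAB n m (n + l) u p)"
proof -
  note c = XX_block_commute[OF u lm, where p = p]
  \<comment> \<open>All sixteen reorderings: twelve commute outright, four acquire a commutator on
    the diagonal \<open>l = m\<close>.\<close>
  have sw: "XX_block u p m 0 l 0 = XX_block u p l 0 m 0" "XX_block u p m 1 l 1 = XX_block u p l 1 m 1"
    "XX_block u p m 2 l 2 = XX_block u p l 2 m 2" "XX_block u p m 3 l 3 = XX_block u p l 3 m 3"
    "XX_block u p m 2 l 0 = XX_block u p l 0 m 2" "XX_block u p m 3 l 0 = XX_block u p l 0 m 3"
    "XX_block u p m 2 l 1 = XX_block u p l 1 m 2" "XX_block u p m 3 l 1 = XX_block u p l 1 m 3"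
    "XX_block u p m 0 l 2 = XX_block u p l 2 m 0" "XX_block u p m 0 l 3 = XX_block u p l 3 m 0"
    "XX_block u p m 1 l 2 = XX_block u p l 2 m 1" "XX_block u p m 1 l 3 = XX_block u p l 3 m 1"
    "XX_block u p m 1 l 0 = XX_block u p l 0 m 1 - (if l = m then 4 * pd 0 u p else 0)"
    "XX_block u p m 0 l 1 = XX_block u p l 1 m 0 + (if l = m then 4 * pd 0 u p else 0)"
    "XX_block u p m 3 l 2 = XX_block u p l 2 m 3 - (if l = m then 4 * pd 0 u p else 0)"
    "XX_block u p m 2 l 3 = XX_block u p l 3 m 2 + (if l = m then 4 * pd 0 u p else 0)"
    by (subst c; simp)+
  note z = DeltaAB_def ZZ_XX_block[OF lm] ZZ_XX_block[OF lm(2,1)] sw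
  show "QQmat u p l m = qpair (2 * DeltaAB n l (n + m) u p) (2 * DeltaAB n l m u p)"
    unfolding z QQmat_XX_block by (simp add: qpair_def Let_def)
  show "DeltaAB n (n + l) (n + m) u p = cnj (DeltaAB n l m u p)"
    unfolding z by (simp add: complex_eq_iff)
  show "DeltaAB n l (n + m) u p = cnj (DeltaAB n m (n + l) u p)"
    unfolding z by (simp add: complex_eq_iff)
qed

theorem theorem1p2:
  fixes n :: nat and u :: "(nat \<Rightarrow> real) \<Rightarrow> real"
  assumes "C2_on_H n u"
  shows "\<forall>p K. quat_of_complex (wedge_pow (Delta n u p) n K)
           = of_nat (fact n) * moore_det n (QQmat u p) * quat_of_complex (Omega n K)"
proof (intro allI)
  fix p K
  let ?a = "\<lambda>A B. DeltaAB n A B u p"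
  have det: "moore_det n (QQmat u p) = qpair (pf n ?a {..<n}) 0"
    unfolding moore_det_eq
    by (rule set_det_pf[of ?a, THEN conjunct1])
      (auto intro: DeltaAB_antisym DeltaAB_entries[OF assms])
  have Omega: "Omega n K = foldr wedge (map omega (omega_list n [0..<n])) form_one K"
    by (simp add: Omega_def omega_list_def)
  \<comment> \<open>At finite \<open>K\<close> this is the top-degree identity; at infinite
    \<open>K\<close> both sides have the default value 0.\<close>
  have "wedge_pow (Delta n u p) n K = fact n * pf n ?a {..<n} * Omega n K"
  proof (cases "finite K")
    case True
    then show ?thesis
      unfolding Omega by (simp add: wedge_pow_Delta wedge2_pow_top foldr_wedge_omega)
  next
    case False
    then show ?thesis
      unfolding Omega by (simp add: wedge_pow_infinite foldr_wedge_infinite)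
  qed
  then show "quat_of_complex (wedge_pow (Delta n u p) n K)
      = of_nat (fact n) * moore_det n (QQmat u p) * quat_of_complex (Omega n K)"
    by (simp add: det quat_of_complex_qpair of_nat_qpair[of "fact n"] qpair_mult)
qed

end
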